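(* Let $D = \bigotimes_{n=1}^{\infty} M_{2^n}$ (the $2^\infty$ UHF algebra), and let $\beta$ be the automorphism of $D$ of order $2$ given by $$\beta = \bigotimes_{n=1}^{\infty} \mathrm{Ad}\left( 1_{2^{n-1}+1} \oplus (-1_{2^{n-1}-1}) \right).$$ Then the action of $\mathbf{Z}_2 = \mathbf{Z}/2\mathbf{Z}$ generated by $\beta$ does not have the strict Rokhlin property.
   Context: Here $1_m$ is the identity of $M_m$; the automorphism in the $n$-th tensor factor is conjugation by a diagonal unitary in $M_{2^n}$ in which $2^{n-1}+1$ diagonal entries are equal to $1$ and $2^{n-1}-1$ diagonal entries are equal to $-1$. Strict Rokhlin property: let $A$ be a unital C*-algebra and let $\alpha \in \mathrm{Aut}(A)$ satisfy $\alpha^n = \mathrm{id}_A$. The action of $\mathbf{Z}_n$ generated by $\alpha$ has the strict Rokhlin property if for every finite set $F \subset A$ and every $\varepsilon > 0$ there are mutually orthogonal projections $e_0, e_1, \dots, e_{n-1} \in A$ such that: (1) $\| \alpha(e_j) - e_{j+1} \| < \varepsilon$ for $0 \le j \le n-2$; (2) $\| e_j a - a e_j \| < \varepsilon$ for $0 \le j \le n-1$ and all $a \in F$; (3) $\sum_{j=0}^{n-1} e_j = 1$. *)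

theory Defs
  imports "HOL-Analysis.Analysis" "Jordan_Normal_Form.Schur_Decomposition"
begin

text \<open>
  Unital C*-algebras over the complex numbers. The norm axiom of the superclass
  excludes only the zero algebra.
\<close>

class cstar_algebra = real_normed_algebra_1 + banach +
  fixes scaleC :: "complex \<Rightarrow> 'a \<Rightarrow> 'a" (infixr "*\<^sub>C" 75)
    and star :: "'a \<Rightarrow> 'a"
  assumes scaleC_add_right: "c *\<^sub>C (x + y) = c *\<^sub>C x + c *\<^sub>C y"
    and scaleC_add_left: "(c + d) *\<^sub>C x = c *\<^sub>C x + d *\<^sub>C x"
    and scaleC_scaleC: "c *\<^sub>C (d *\<^sub>C x) = (c * d) *\<^sub>C x"
    and scaleC_of_real: "complex_of_real r *\<^sub>C x = r *\<^sub>R x"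
    and mult_scaleC_left: "(c *\<^sub>C x) * y = c *\<^sub>C (x * y)"
    and mult_scaleC_right: "x * (c *\<^sub>C y) = c *\<^sub>C (x * y)"
    and norm_scaleC: "norm (c *\<^sub>C x) = cmod c * norm x"
    and star_add: "star (x + y) = star x + star y"
    and star_scaleC: "star (c *\<^sub>C x) = cnj c *\<^sub>C star x"
    and star_mult: "star (x * y) = star y * star x"
    and star_star: "star (star x) = x"
    and norm_star_mult: "norm (star x * x) = (norm x)\<^sup>2"

definition star_automorphism :: "('a::cstar_algebra \<Rightarrow> 'a) \<Rightarrow> bool" where
  "star_automorphism \<alpha> \<longleftrightarrow> bij \<alpha> \<and> (\<forall>x y. \<alpha> (x + y) = \<alpha> x + \<alpha> y) \<and> (\<forall>c x. \<alpha> (c *\<^sub>C x) = c *\<^sub>C \<alpha> x) \<and>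
     (\<forall>x y. \<alpha> (x * y) = \<alpha> x * \<alpha> y) \<and> (\<forall>x. \<alpha> (star x) = star (\<alpha> x))"

definition is_projection :: "'a::cstar_algebra \<Rightarrow> bool" where
  "is_projection e \<longleftrightarrow> star e = e \<and> e * e = e"

text \<open>
  The definition presupposes that \<open>\<alpha>\<close> is an automorphism with \<open>\<alpha>\<close> composed \<open>n\<close> times
  equal to the identity; for the automorphism \<open>beta\<close> below this is proved in
  \<open>beta_automorphism\<close> and \<open>beta_beta\<close>. The index bound \<open>j + 2 \<le> n\<close> is
  \<open>j \<le> n - 2\<close> without truncated subtraction.
\<close>

definition strict_rokhlin_property :: "nat \<Rightarrow> ('a::cstar_algebra \<Rightarrow> 'a) \<Rightarrow> bool" where
  "strict_rokhlin_property n \<alpha> \<longleftrightarrow>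
     (\<forall>F \<epsilon>. finite F \<longrightarrow> 0 < \<epsilon> \<longrightarrow>
       (\<exists>e :: nat \<Rightarrow> 'a.
          (\<forall>j<n. is_projection (e j)) \<and>
          (\<forall>i<n. \<forall>j<n. i \<noteq> j \<longrightarrow> e i * e j = 0) \<and>
          (\<forall>j. j + 2 \<le> n \<longrightarrow> norm (\<alpha> (e j) - e (j + 1)) < \<epsilon>) \<and>
          (\<forall>j<n. \<forall>a\<in>F. norm (e j * a - a * e j) < \<epsilon>) \<and>
          (\<Sum>j<n. e j) = 1))"

definition sq_summable :: "('i \<Rightarrow> complex) \<Rightarrow> bool" where
  "sq_summable f \<longleftrightarrow> (\<lambda>i. (cmod (f i))\<^sup>2) summable_on UNIV"

lemma sq_summable_inner:
  assumes "sq_summable f" "sq_summable g"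
  shows "(\<lambda>i. inner (f i) (g i)) summable_on UNIV"
proof -
  have s: "(\<lambda>i. (cmod (f i))\<^sup>2 + (cmod (g i))\<^sup>2) summable_on UNIV"
    using assms unfolding sq_summable_def by (rule summable_on_add)
  have "(\<lambda>i. norm (inner (f i) (g i))) summable_on UNIV"
  proof (rule summable_on_comparison_test[OF s])
    fix i
    have "norm (inner (f i) (g i)) \<le> cmod (f i) * cmod (g i)"
      using Cauchy_Schwarz_ineq2 by auto
    also have "\<dots> \<le> (cmod (f i))\<^sup>2 + (cmod (g i))\<^sup>2"
      using sum_squares_bound[of "cmod (f i)" "cmod (g i)"]
        mult_nonneg_nonneg[OF norm_ge_zero[of "f i"] norm_ge_zero[of "g i"]]
      by linarith
    finally show "norm (inner (f i) (g i)) \<le> (cmod (f i))\<^sup>2 + (cmod (g i))\<^sup>2" .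
  qed auto
  then show ?thesis by (rule abs_summable_summable)
qed

lemma sq_summable_add:
  assumes "sq_summable f" "sq_summable g"
  shows "sq_summable (\<lambda>i. f i + g i)"
proof -
  have "(\<lambda>i. (cmod (f i))\<^sup>2 + (cmod (g i))\<^sup>2 + 2 * inner (f i) (g i)) summable_on UNIV"
    by (intro summable_on_add summable_on_cmult_right sq_summable_inner assms
        assms[unfolded sq_summable_def])
  moreover have "(\<lambda>i. (cmod (f i + g i))\<^sup>2) = (\<lambda>i. (cmod (f i))\<^sup>2 + (cmod (g i))\<^sup>2 + 2 * inner (f i) (g i))"
    by (auto simp: power2_norm_eq_inner inner_add_left inner_add_right inner_commute)
  ultimately show ?thesis unfolding sq_summable_def by simp
qed

lemma weighted_reindex:
  assumes f: "sq_summable f" and inj: "inj_on g {s. P s}" and c: "\<And>s. P s \<Longrightarrow> cmod (c s) \<le> C"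
  shows "sq_summable (\<lambda>s. if P s then c s * f (g s) else 0)" (is "sq_summable ?h")
    and "(\<Sum>\<^sub>\<infinity>s. (cmod (if P s then c s * f (g s) else 0))\<^sup>2) \<le> C\<^sup>2 * (\<Sum>\<^sub>\<infinity>s. (cmod (f s))\<^sup>2)"
proof -
  let ?A = "{s. P s}" and ?q = "\<lambda>s. (cmod (f s))\<^sup>2"
  have sI: "?q summable_on g ` ?A"
    using f summable_on_subset_banach[of ?q UNIV] unfolding sq_summable_def by auto
  have "?q summable_on UNIV" using f unfolding sq_summable_def .
  have s1: "(?q \<circ> g) summable_on ?A"
    using sI summable_on_reindex[OF inj] by blast
  have "infsum (?q \<circ> g) ?A = infsum ?q (g ` ?A)"
    by (simp add: infsum_reindex[OF inj])
  also have "\<dots> \<le> infsum ?q UNIV"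
    by (rule infsum_mono2) (use sI f in \<open>auto simp: sq_summable_def\<close>)
  finally have le: "infsum (?q \<circ> g) ?A \<le> infsum ?q UNIV" .
  have s2: "(\<lambda>s. C\<^sup>2 * (?q \<circ> g) s) summable_on ?A"
    by (rule summable_on_cmult_right[OF s1])
  have pt: "(cmod (c s * f (g s)))\<^sup>2 \<le> C\<^sup>2 * (?q \<circ> g) s" if "s \<in> ?A" for s
    using c[of s] that by (simp add: norm_mult power_mult_distrib mult_right_mono power_mono)
  have s3: "(\<lambda>s. (cmod (c s * f (g s)))\<^sup>2) summable_on ?A"
    by (rule summable_on_comparison_test[OF s2 pt]) auto
  have s4: "((\<lambda>s. (cmod (?h s))\<^sup>2) summable_on UNIV) = ((\<lambda>s. (cmod (c s * f (g s)))\<^sup>2) summable_on ?A)"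
    by (rule summable_on_cong_neutral) auto
  show "sq_summable ?h" using s3 s4 unfolding sq_summable_def by simp
  have "(\<Sum>\<^sub>\<infinity>s. (cmod (?h s))\<^sup>2) = infsum (\<lambda>s. (cmod (c s * f (g s)))\<^sup>2) ?A"
    by (rule infsum_cong_neutral) auto
  also have "\<dots> \<le> infsum (\<lambda>s. C\<^sup>2 * (?q \<circ> g) s) ?A"
    by (rule infsum_mono[OF s3 s2 pt])
  also have "\<dots> = C\<^sup>2 * infsum (?q \<circ> g) ?A" by (rule infsum_cmult_right')
  also have "\<dots> \<le> C\<^sup>2 * infsum ?q UNIV" by (rule mult_left_mono[OF le]) simp
  finally show "(\<Sum>\<^sub>\<infinity>s. (cmod (?h s))\<^sup>2) \<le> C\<^sup>2 * infsum ?q UNIV" .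
qed

text \<open>
  The complex Hilbert space of square-summable families. As an instance of
  \<open>real_inner\<close> it carries the real part of the Hermitian inner product, which has the same
  norm; for a complex-linear operator, adjoints for either of the two products coincide.
\<close>

typedef 'i ell2 = "{f :: 'i \<Rightarrow> complex. sq_summable f}"
  morphisms coord Abs_ell2
  by (rule exI[of _ "\<lambda>_. 0"]) (simp add: sq_summable_def)

setup_lifting type_definition_ell2

lemma sq_summable_cmult:
  assumes "sq_summable f" shows "sq_summable (\<lambda>i. c * f i)"
  using weighted_reindex(1)[OF assms, of id "\<lambda>_. True" "\<lambda>_. c" "cmod c"] by simp

lemma sq_summable_coord: "sq_summable (coord f)"
  using coord by auto

instantiation ell2 :: (type) real_vector
begin

lift_definition zero_ell2 :: "'a ell2" is "\<lambda>_. 0" by (simp add: sq_summable_def)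
lift_definition plus_ell2 :: "'a ell2 \<Rightarrow> 'a ell2 \<Rightarrow> 'a ell2" is "\<lambda>f g i. f i + g i"
  by (rule sq_summable_add)
lift_definition uminus_ell2 :: "'a ell2 \<Rightarrow> 'a ell2" is "\<lambda>f i. - f i"
  by (simp add: sq_summable_def)
lift_definition minus_ell2 :: "'a ell2 \<Rightarrow> 'a ell2 \<Rightarrow> 'a ell2" is "\<lambda>f g i. f i - g i"
proof -
  fix f g :: "'a \<Rightarrow> complex" assume "sq_summable f" "sq_summable g"
  then show "sq_summable (\<lambda>i. f i - g i)"
    using sq_summable_add[of f "\<lambda>i. - g i"] by (simp add: sq_summable_def)
qed
lift_definition scaleR_ell2 :: "real \<Rightarrow> 'a ell2 \<Rightarrow> 'a ell2" is "\<lambda>r f i. r *\<^sub>R f i"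
  using sq_summable_cmult by (auto simp: scaleR_conv_of_real)
instance
  by standard (transfer; auto simp: algebra_simps)+

end

instantiation ell2 :: (type) real_inner
begin

lift_definition inner_ell2 :: "'a ell2 \<Rightarrow> 'a ell2 \<Rightarrow> real" is
  "\<lambda>f g. \<Sum>\<^sub>\<infinity>i. inner (f i) (g i)" .
definition norm_ell2 :: "'a ell2 \<Rightarrow> real" where "norm_ell2 x = sqrt (inner x x)"
definition sgn_ell2 :: "'a ell2 \<Rightarrow> 'a ell2" where "sgn_ell2 x = x /\<^sub>R norm x"
definition dist_ell2 :: "'a ell2 \<Rightarrow> 'a ell2 \<Rightarrow> real" where "dist_ell2 x y = norm (x - y)"
definition uniformity_ell2 :: "('a ell2 \<times> 'a ell2) filter" where
  [code del]: "uniformity_ell2 = (INF e\<in>{0<..}. principal {(x, y). dist x y < e})"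
definition open_ell2 :: "'a ell2 set \<Rightarrow> bool" where
  [code del]: "open_ell2 U \<longleftrightarrow> (\<forall>x\<in>U. eventually (\<lambda>(x', y). x' = x \<longrightarrow> y \<in> U) uniformity)"

instance
proof
  fix x y z :: "'a ell2" and r :: real
  show "inner x y = inner y x" by transfer (simp add: inner_commute)
  show "inner (x + y) z = inner x z + inner y z"
    by transfer (simp add: inner_add_left infsum_add sq_summable_inner)
  show "inner (r *\<^sub>R x) y = r * inner x y"
    by transfer (simp add: infsum_cmult_right')
  show "0 \<le> inner x x" by transfer (simp add: infsum_nonneg)
  show "inner x x = 0 \<longleftrightarrow> x = 0"
  proof
    assume "inner x x = 0"
    then show "x = 0"
    proof transfer
      fix f :: "'a \<Rightarrow> complex"
      assume f: "sq_summable f" and 0: "(\<Sum>\<^sub>\<infinity>i. inner (f i) (f i)) = 0"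
      have "inner (f i) (f i) = 0" for i
        by (rule nonneg_infsum_le_0D[of "\<lambda>i. inner (f i) (f i)" UNIV])
          (use 0 sq_summable_inner[OF f f] in auto)
      then show "f = (\<lambda>_. 0)" by auto
    qed
  qed (transfer, simp)
  show "norm x = sqrt (inner x x)" by (rule norm_ell2_def)
qed (rule sgn_ell2_def dist_ell2_def uniformity_ell2_def open_ell2_def)+

end

lemma norm_ell2_sq: "(norm x)\<^sup>2 = (\<Sum>\<^sub>\<infinity>i. (cmod (coord x i))\<^sup>2)"
  by (simp add: power2_norm_eq_inner inner_ell2.rep_eq)

lemma coord_summable: "(\<lambda>i. (cmod (coord x i))\<^sup>2) summable_on UNIV"
  using sq_summable_coord[of x] unfolding sq_summable_def .

lemma sum_coord_le:
  assumes "finite F" shows "(\<Sum>i\<in>F. (cmod (coord x i))\<^sup>2) \<le> (norm x)\<^sup>2"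
  unfolding norm_ell2_sq by (rule finite_sum_le_infsum[OF coord_summable assms]) auto

lemma coord_le_norm: "cmod (coord x i) \<le> norm x"
  by (rule power2_le_imp_le) (use sum_coord_le[of "{i}" x] in simp_all)

lemma norm_ell2_le:
  assumes "0 \<le> C" and "\<And>F. finite F \<Longrightarrow> (\<Sum>i\<in>F. (cmod (coord x i))\<^sup>2) \<le> C\<^sup>2"
  shows "norm x \<le> C"
proof (rule power2_le_imp_le[OF _ assms(1)])
  show "(norm x)\<^sup>2 \<le> C\<^sup>2" unfolding norm_ell2_sq
    by (rule infsum_le_finite_sums[OF coord_summable]) (rule assms(2))
qed

instance ell2 :: (type) banach
proof
  fix X :: "nat \<Rightarrow> 'a ell2" assume X: "Cauchy X"
  have "Cauchy (\<lambda>n. coord (X n) i)" for i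
  proof (rule CauchyI)
    fix e :: real assume "0 < e"
    then obtain M where M: "\<And>m n. m \<ge> M \<Longrightarrow> n \<ge> M \<Longrightarrow> norm (X m - X n) < e"
      using CauchyD[OF X] by blast
    show "\<exists>M. \<forall>m\<ge>M. \<forall>n\<ge>M. norm (coord (X m) i - coord (X n) i) < e"
      using M coord_le_norm[of "X _ - X _" i] by (metis minus_ell2.rep_eq order.strict_trans1)
  qed
  then have "\<exists>l. (\<lambda>n. coord (X n) i) \<longlonglongrightarrow> l" for i
    by (metis Cauchy_convergent convergent_def)
  then obtain f where f: "\<And>i. (\<lambda>n. coord (X n) i) \<longlonglongrightarrow> f i" by metis
  have fin: "\<exists>M. \<forall>m\<ge>M. \<forall>F. finite F \<longrightarrow> (\<Sum>i\<in>F. (cmod (coord (X m) i - f i))\<^sup>2) \<le> e\<^sup>2"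
    if "0 < e" for e :: real
  proof -
    obtain M where M: "\<And>m n. m \<ge> M \<Longrightarrow> n \<ge> M \<Longrightarrow> norm (X m - X n) < e"
      using CauchyD[OF X \<open>0 < e\<close>] by blast
    have "(\<Sum>i\<in>F. (cmod (coord (X m) i - f i))\<^sup>2) \<le> e\<^sup>2" if m: "m \<ge> M" and F: "finite F" for m F
    proof (rule LIMSEQ_le_const2)
      show "(\<lambda>n. \<Sum>i\<in>F. (cmod (coord (X m) i - coord (X n) i))\<^sup>2) \<longlonglongrightarrow> (\<Sum>i\<in>F. (cmod (coord (X m) i - f i))\<^sup>2)"
        by (intro tendsto_intros f)
      have "(\<Sum>i\<in>F. (cmod (coord (X m) i - coord (X n) i))\<^sup>2) \<le> e\<^sup>2" if "n \<ge> M" for n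
      proof -
        have "(\<Sum>i\<in>F. (cmod (coord (X m - X n) i))\<^sup>2) \<le> (norm (X m - X n))\<^sup>2"
          by (rule sum_coord_le[OF F])
        also have "\<dots> \<le> e\<^sup>2" using M[OF m that] by (intro power_mono) auto
        finally show ?thesis by (simp add: minus_ell2.rep_eq)
      qed
      then show "\<exists>N. \<forall>n\<ge>N. (\<Sum>i\<in>F. (cmod (coord (X m) i - coord (X n) i))\<^sup>2) \<le> e\<^sup>2" by blast
    qed
    then show ?thesis by blast
  qed
  obtain M where M: "\<And>F. finite F \<Longrightarrow> (\<Sum>i\<in>F. (cmod (coord (X M) i - f i))\<^sup>2) \<le> 1"
    using fin[of 1] by auto
  have "sq_summable (\<lambda>i. coord (X M) i - f i)"
    unfolding sq_summable_def
    by (rule nonneg_bdd_above_summable_on) (auto intro!: bdd_aboveI2[where M = 1] M)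
  then have "sq_summable (\<lambda>i. coord (X M) i + (-1) * (coord (X M) i - f i))"
    by (intro sq_summable_add sq_summable_cmult sq_summable_coord)
  then have sf: "sq_summable f" by simp
  define L where "L = Abs_ell2 f"
  have L: "coord L = f" unfolding L_def using sf by (simp add: Abs_ell2_inverse)
  have "X \<longlonglongrightarrow> L"
  proof (rule LIMSEQ_I)
    fix r :: real assume "0 < r"
    then obtain M where M: "\<And>m F. m \<ge> M \<Longrightarrow> finite F \<Longrightarrow> (\<Sum>i\<in>F. (cmod (coord (X m) i - f i))\<^sup>2) \<le> (r/2)\<^sup>2"
      using fin[of "r/2"] by auto
    have "norm (X m - L) < r" if "m \<ge> M" for m
    proof -
      have "norm (X m - L) \<le> r/2"
        by (rule norm_ell2_le) (use M[OF that] L \<open>0 < r\<close> in \<open>auto simp: minus_ell2.rep_eq\<close>)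
      then show ?thesis using \<open>0 < r\<close> by simp
    qed
    then show "\<exists>no. \<forall>n\<ge>no. norm (X n - L) < r" by blast
  qed
  then show "convergent X" by (auto simp: convergent_def)
qed

lift_definition cmul :: "complex \<Rightarrow> 'i ell2 \<Rightarrow> 'i ell2" is "\<lambda>c f i. c * f i"
  by (rule sq_summable_cmult)

lemma weighted_reindex_norm:
  assumes "\<And>s. coord y s = (if P s then c s * coord x (g s) else 0)"
    and "inj_on g {s. P s}" and "\<And>s. P s \<Longrightarrow> cmod (c s) \<le> C" and "0 \<le> C"
  shows "norm y \<le> C * norm x"
proof (rule power2_le_imp_le)
  show "(norm y)\<^sup>2 \<le> (C * norm x)\<^sup>2"
    using weighted_reindex(2)[where f = "coord x", OF sq_summable_coord assms(2,3)]
    by (simp add: power_mult_distrib norm_ell2_sq assms(1))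
qed (use assms(4) in simp)

lemma ell2_eqI: "(\<And>i. coord x i = coord y i) \<Longrightarrow> x = y"
  by (rule coord_inject[THEN iffD1], rule ext)

lemmas coord_simps = plus_ell2.rep_eq minus_ell2.rep_eq uminus_ell2.rep_eq zero_ell2.rep_eq
  scaleR_ell2.rep_eq cmul.rep_eq

lift_definition cmul_op :: "complex \<Rightarrow> 'i ell2 \<Rightarrow>\<^sub>L 'i ell2" is cmul
proof -
  fix c :: complex
  show "bounded_linear (cmul c :: 'i ell2 \<Rightarrow> 'i ell2)"
  proof (rule bounded_linear_intro)
    fix x y :: "'i ell2" and r :: real
    show "cmul c (x + y) = cmul c x + cmul c y" "cmul c (r *\<^sub>R x) = r *\<^sub>R cmul c x"
      by (rule ell2_eqI; simp add: coord_simps algebra_simps)+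
    have "norm (cmul c x) \<le> cmod c * norm x"
      by (rule weighted_reindex_norm[where P = "\<lambda>_. True" and g = id and c = "\<lambda>_. c"])
        (auto simp: coord_simps)
    then show "norm (cmul c x) \<le> norm x * cmod c" by (simp add: mult.commute)
  qed
qed

text \<open>
  The standard basis of the Hilbert space tensor product of the spaces of dimension
  \<open>2 ^ n\<close>, \<open>n \<ge> 1\<close>, along the first basis vectors: sequences of basis labels, all but finitely
  many of them \<open>0\<close>. At \<open>n = 0\<close> the label is forced to be \<open>0\<close>, so there is no factor there.
\<close>

typedef multi_index = "{s :: nat \<Rightarrow> nat. (\<forall>n. s n < 2 ^ n) \<and> finite {n. s n \<noteq> 0}}"
  morphisms digit Abs_multi_index
  by (rule exI[of _ "\<lambda>_. 0"]) simp

setup_lifting type_definition_multi_index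

lift_definition set_digit :: "multi_index \<Rightarrow> nat \<Rightarrow> nat \<Rightarrow> multi_index" is
  "\<lambda>s n j. if j < 2 ^ n then s(n := j) else s"
proof -
  fix s :: "nat \<Rightarrow> nat" and n j :: nat
  assume s: "(\<forall>n. s n < 2 ^ n) \<and> finite {n. s n \<noteq> 0}"
  have "finite {k. (s(n := j)) k \<noteq> 0}"
    by (rule finite_subset[of _ "insert n {k. s k \<noteq> 0}"]) (use s in auto)
  then show "(\<forall>k. (if j < 2 ^ n then s(n := j) else s) k < 2 ^ k) \<and>
      finite {k. (if j < 2 ^ n then s(n := j) else s) k \<noteq> 0}"
    using s by auto
qed

lemma digit_set_digit: "j < 2 ^ n \<Longrightarrow> digit (set_digit s n j) = (digit s)(n := j)"
  by transfer simp

lemma digit_less: "digit s n < 2 ^ n"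
  using digit[of s] by auto

lemma multi_index_eqI: "(\<And>n. digit s n = digit t n) \<Longrightarrow> s = t"
  by (rule digit_inject[THEN iffD1], rule ext)

lemma set_digit_same: "j < 2 ^ n \<Longrightarrow> k < 2 ^ n \<Longrightarrow> set_digit (set_digit s n j) n k = set_digit s n k"
  by (rule multi_index_eqI) (simp add: digit_set_digit)

lemma set_digit_commute:
  "m \<noteq> n \<Longrightarrow> j < 2 ^ m \<Longrightarrow> k < 2 ^ n \<Longrightarrow>
    set_digit (set_digit s m j) n k = set_digit (set_digit s n k) m j"
  by (rule multi_index_eqI) (simp add: digit_set_digit)

lemma set_digit_digit: "set_digit s n (digit s n) = s"
  by (rule multi_index_eqI) (simp add: digit_set_digit digit_less)

lemma set_digit_inj: "j < 2 ^ n \<Longrightarrow> inj_on (\<lambda>s. set_digit s n j) {s. digit s n = i}"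
proof (rule inj_onI)
  fix s t
  assume j: "j < 2 ^ n" and s: "s \<in> {s. digit s n = i}" and t: "t \<in> {s. digit s n = i}"
    and eq: "set_digit s n j = set_digit t n j"
  have i: "i < 2 ^ n" using s digit_less[of s n] by simp
  have "set_digit (set_digit s n j) n i = set_digit (set_digit t n j) n i" using eq by simp
  then have "set_digit s n i = set_digit t n i" by (simp add: set_digit_same i j)
  then show "s = t" using s t set_digit_digit[of s n] set_digit_digit[of t n] by simp
qed

text \<open>
  The matrix unit at position \<open>(i, j)\<close>, acting on the \<open>n\<close>-th tensor factor.
\<close>

lift_definition unit_map :: "nat \<Rightarrow> nat \<Rightarrow> nat \<Rightarrow> multi_index ell2 \<Rightarrow> multi_index ell2" is
  "\<lambda>n i j f s. if digit s n = i \<and> j < 2 ^ n then f (set_digit s n j) else 0"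
proof -
  fix n i j and f :: "multi_index \<Rightarrow> complex"
  assume f: "sq_summable f"
  show "sq_summable (\<lambda>s. if digit s n = i \<and> j < 2 ^ n then f (set_digit s n j) else 0)"
  proof (cases "j < 2 ^ n")
    case True
    then show ?thesis
      using weighted_reindex(1)[OF f, of "\<lambda>s. set_digit s n j" "\<lambda>s. digit s n = i" "\<lambda>_. 1" 1]
        set_digit_inj[of j n i] by (simp cong: if_cong)
  qed (simp add: sq_summable_def)
qed

lift_definition unit_op :: "nat \<Rightarrow> nat \<Rightarrow> nat \<Rightarrow> multi_index ell2 \<Rightarrow>\<^sub>L multi_index ell2" is unit_map
proof -
  fix n i j
  show "bounded_linear (unit_map n i j)"
  proof (rule bounded_linear_intro)
    fix x y :: "multi_index ell2" and r :: real
    show "unit_map n i j (x + y) = unit_map n i j x + unit_map n i j y"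
      "unit_map n i j (r *\<^sub>R x) = r *\<^sub>R unit_map n i j x"
      by (rule ell2_eqI; simp add: coord_simps unit_map.rep_eq)+
    have "norm (unit_map n i j x) \<le> 1 * norm x"
    proof (cases "j < 2 ^ n")
      case True
      then show ?thesis
        by (intro weighted_reindex_norm[where P = "\<lambda>s. digit s n = i" and c = "\<lambda>_. 1"
              and g = "\<lambda>s. set_digit s n j"])
          (auto simp: unit_map.rep_eq set_digit_inj)
    next
      case False
      then have "unit_map n i j x = 0"
        by (intro ell2_eqI) (simp add: unit_map.rep_eq coord_simps)
      then show ?thesis by simp
    qed
    then show "norm (unit_map n i j x) \<le> norm x * 1" by simp
  qed
qed

text \<open>
  \<open>leg_op n x\<close> is the matrix \<open>x\<close>, of size \<open>2 ^ n\<close>, acting on the \<open>n\<close>-th tensor factor, that is,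
  the elementary tensor with \<open>x\<close> in position \<open>n\<close> and identities elsewhere.
\<close>

definition leg_op :: "nat \<Rightarrow> complex mat \<Rightarrow> multi_index ell2 \<Rightarrow>\<^sub>L multi_index ell2" where
  "leg_op n x = (\<Sum>i<2 ^ n. \<Sum>j<2 ^ n. cmul_op (x $$ (i, j)) o\<^sub>L unit_op n i j)"

lemma coord_sum: "coord (\<Sum>a\<in>A. f a) i = (\<Sum>a\<in>A. coord (f a) i)"
  by (induction A rule: infinite_finite_induct) (simp_all add: coord_simps)

lemma coord_leg_op:
  "coord (leg_op n x f) s = (\<Sum>j<2 ^ n. x $$ (digit s n, j) * coord f (set_digit s n j))"
proof -
  have "coord (leg_op n x f) s =
      (\<Sum>i<2 ^ n. \<Sum>j<2 ^ n. if i = digit s n then x $$ (i, j) * coord f (set_digit s n j) else 0)"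
    unfolding leg_op_def
    by (simp only: blinfun.sum_left coord_sum, intro sum.cong refl)
      (simp add: coord_simps cmul_op.rep_eq unit_op.rep_eq unit_map.rep_eq)
  also have "\<dots> = (\<Sum>i<2 ^ n. if i = digit s n then \<Sum>j<2 ^ n. x $$ (i, j) * coord f (set_digit s n j) else 0)"
    by (rule sum.cong) auto
  also have "\<dots> = (\<Sum>j<2 ^ n. x $$ (digit s n, j) * coord f (set_digit s n j))"
    using digit_less[of s n] by (simp add: sum.delta)
  finally show ?thesis .
qed

lemma op_eqI:
  fixes S T :: "'i ell2 \<Rightarrow>\<^sub>L 'j ell2"
  shows "(\<And>f s. coord (S f) s = coord (T f) s) \<Longrightarrow> S = T"
  by (intro blinfun_eqI ell2_eqI)

lemma leg_op_add:
  assumes "x \<in> carrier_mat (2 ^ n) (2 ^ n)" "y \<in> carrier_mat (2 ^ n) (2 ^ n)"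
  shows "leg_op n (x + y) = leg_op n x + leg_op n y"
  by (rule op_eqI) (use assms digit_less in \<open>simp add: coord_leg_op coord_simps plus_blinfun.rep_eq
      sum.distrib algebra_simps\<close>)

lemma leg_op_smult:
  assumes "x \<in> carrier_mat (2 ^ n) (2 ^ n)"
  shows "leg_op n (c \<cdot>\<^sub>m x) = cmul_op c o\<^sub>L leg_op n x"
  by (rule op_eqI) (use assms digit_less in \<open>simp add: coord_leg_op coord_simps cmul_op.rep_eq
      sum_distrib_left algebra_simps\<close>)

lemma leg_op_one: "leg_op n (1\<^sub>m (2 ^ n)) = id_blinfun"
proof (rule op_eqI)
  fix f s
  have "coord (leg_op n (1\<^sub>m (2 ^ n)) f) s = (\<Sum>j<2 ^ n. if j = digit s n then coord f s else 0)"
    unfolding coord_leg_op by (rule sum.cong) (auto simp: digit_less set_digit_digit)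
  then show "coord (leg_op n (1\<^sub>m (2 ^ n)) f) s = coord (id_blinfun f) s"
    using digit_less[of s n] by (simp add: sum.delta)
qed

lemma leg_op_mult:
  assumes x: "x \<in> carrier_mat (2 ^ n) (2 ^ n)" and y: "y \<in> carrier_mat (2 ^ n) (2 ^ n)"
  shows "leg_op n (x * y) = leg_op n x o\<^sub>L leg_op n y"
proof (rule op_eqI)
  fix f s
  have "coord ((leg_op n x o\<^sub>L leg_op n y) f) s =
      (\<Sum>j<2 ^ n. \<Sum>k<2 ^ n. x $$ (digit s n, j) * (y $$ (j, k) * coord f (set_digit s n k)))"
    by (simp add: coord_leg_op sum_distrib_left digit_set_digit set_digit_same)
  also have "\<dots> = (\<Sum>k<2 ^ n. \<Sum>j<2 ^ n. x $$ (digit s n, j) * (y $$ (j, k) * coord f (set_digit s n k)))"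
    by (rule sum.swap)
  also have "\<dots> = (\<Sum>k<2 ^ n. (x * y) $$ (digit s n, k) * coord f (set_digit s n k))"
    using x y digit_less[of s n]
    by (intro sum.cong) (auto simp: scalar_prod_def atLeast0LessThan sum_distrib_right mult.assoc)
  finally show "coord (leg_op n (x * y) f) s = coord ((leg_op n x o\<^sub>L leg_op n y) f) s"
    by (simp add: coord_leg_op)
qed

lemma leg_op_commute:
  assumes "m \<noteq> n"
  shows "leg_op m x o\<^sub>L leg_op n y = leg_op n y o\<^sub>L leg_op m x"
proof (rule op_eqI)
  fix f s
  have "coord ((leg_op m x o\<^sub>L leg_op n y) f) s =
      (\<Sum>j<2 ^ m. \<Sum>k<2 ^ n. x $$ (digit s m, j) * (y $$ (digit s n, k) * coord f (set_digit (set_digit s n k) m j)))"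
    using assms by (simp add: coord_leg_op sum_distrib_left digit_set_digit set_digit_commute)
  also have "\<dots> = (\<Sum>k<2 ^ n. \<Sum>j<2 ^ m. x $$ (digit s m, j) * (y $$ (digit s n, k) * coord f (set_digit (set_digit s n k) m j)))"
    by (rule sum.swap)
  also have "\<dots> = coord ((leg_op n y o\<^sub>L leg_op m x) f) s"
    using assms by (simp add: coord_leg_op sum_distrib_left digit_set_digit ac_simps)
  finally show "coord ((leg_op m x o\<^sub>L leg_op n y) f) s = coord ((leg_op n y o\<^sub>L leg_op m x) f) s" .
qed

definition is_adj :: "('i ell2 \<Rightarrow>\<^sub>L 'i ell2) \<Rightarrow> ('i ell2 \<Rightarrow>\<^sub>L 'i ell2) \<Rightarrow> bool" where
  "is_adj T S \<longleftrightarrow> (\<forall>x y. inner (T x) y = inner x (S y))"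

lemma is_adj_add: "is_adj T S \<Longrightarrow> is_adj T' S' \<Longrightarrow> is_adj (T + T') (S + S')"
  by (simp add: is_adj_def blinfun.add_left inner_add_left inner_add_right)

lemma is_adj_compose: "is_adj T S \<Longrightarrow> is_adj T' S' \<Longrightarrow> is_adj (T o\<^sub>L T') (S' o\<^sub>L S)"
  by (simp add: is_adj_def)

lemma is_adj_cmul: "is_adj (cmul_op c) (cmul_op (cnj c))"
  unfolding is_adj_def
  by (auto simp: inner_ell2.rep_eq cmul_op.rep_eq coord_simps inner_complex_def algebra_simps intro!: infsum_cong)

lemma is_adj_sum: "(\<And>a. a \<in> A \<Longrightarrow> is_adj (T a) (S a)) \<Longrightarrow> is_adj (\<Sum>a\<in>A. T a) (\<Sum>a\<in>A. S a)"
  by (simp add: is_adj_def blinfun.sum_left inner_sum_left inner_sum_right)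

lemma is_adj_unit:
  assumes "i < 2 ^ n" "j < 2 ^ n"
  shows "is_adj (unit_op n i j) (unit_op n j i)"
  unfolding is_adj_def
proof (intro allI)
  fix x y :: "multi_index ell2"
  let ?A = "\<lambda>i. {s. digit s n = i}"
  have "inner (unit_op n i j x) y = (\<Sum>\<^sub>\<infinity>s\<in>?A i. inner (coord x (set_digit s n j)) (coord y s))"
    unfolding inner_ell2.rep_eq unit_op.rep_eq unit_map.rep_eq
    by (rule infsum_cong_neutral) (use assms in auto)
  also have "\<dots> = (\<Sum>\<^sub>\<infinity>s\<in>?A i. inner (coord x (set_digit s n j)) (coord y (set_digit (set_digit s n j) n i)))"
    using assms by (intro infsum_cong) (auto simp: set_digit_same set_digit_digit)
  also have "\<dots> = (\<Sum>\<^sub>\<infinity>s\<in>?A j. inner (coord x s) (coord y (set_digit s n i)))"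
  proof (rule infsum_reindex_bij_betw[where g = "\<lambda>s. set_digit s n j" and f = "\<lambda>s. inner (coord x s) (coord y (set_digit s n i))"])
    show "bij_betw (\<lambda>s. set_digit s n j) (?A i) (?A j)"
      by (rule bij_betw_byWitness[where f' = "\<lambda>s. set_digit s n i"])
        (use assms in \<open>auto simp: set_digit_same set_digit_digit digit_set_digit\<close>)
  qed
  also have "\<dots> = inner x (unit_op n j i y)"
    unfolding inner_ell2.rep_eq unit_op.rep_eq unit_map.rep_eq
    by (rule infsum_cong_neutral) (use assms in auto)
  finally show "inner (unit_op n i j x) y = inner x (unit_op n j i y)" .
qed

lemma cmul_unit_commute: "unit_op n i j o\<^sub>L cmul_op c = cmul_op c o\<^sub>L unit_op n i j"
  by (rule op_eqI) (simp add: unit_op.rep_eq cmul_op.rep_eq unit_map.rep_eq coord_simps)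

lemma cmul_leg_commute: "leg_op n x o\<^sub>L cmul_op c = cmul_op c o\<^sub>L leg_op n x"
  by (rule op_eqI) (simp add: coord_leg_op cmul_op.rep_eq coord_simps sum_distrib_left ac_simps)

lemma mat_adjoint_index:
  fixes x :: "complex mat"
  assumes "x \<in> carrier_mat m n" "i < n" "j < m"
  shows "mat_adjoint x $$ (i, j) = cnj (x $$ (j, i))"
  using assms by (simp add: mat_adjoint_def mat_of_rows_index)

lemma mat_adjoint_carrier: "x \<in> carrier_mat m n \<Longrightarrow> mat_adjoint (x :: complex mat) \<in> carrier_mat n m"
  by (auto simp: mat_adjoint_def)

lemma is_adj_leg:
  assumes x: "x \<in> carrier_mat (2 ^ n) (2 ^ n)"
  shows "is_adj (leg_op n x) (leg_op n (mat_adjoint x))"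
proof -
  have "is_adj (leg_op n x) (\<Sum>i<2 ^ n. \<Sum>j<2 ^ n. unit_op n j i o\<^sub>L cmul_op (cnj (x $$ (i, j))))"
    unfolding leg_op_def by (intro is_adj_sum is_adj_compose is_adj_cmul is_adj_unit) auto
  also have "(\<Sum>i<2 ^ n. \<Sum>j<2 ^ n. unit_op n j i o\<^sub>L cmul_op (cnj (x $$ (i, j)))) = leg_op n (mat_adjoint x)"
    unfolding leg_op_def
    by (subst sum.swap) (use x in \<open>simp add: cmul_unit_commute mat_adjoint_index\<close>)
  finally show ?thesis .
qed

interpretation op_comp: bounded_bilinear "(o\<^sub>L)"
  by (rule bounded_bilinear_blinfun_compose)

lemma op_compose_assoc: "(R o\<^sub>L S) o\<^sub>L T = R o\<^sub>L (S o\<^sub>L T)"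
  by (rule blinfun_eqI) simp

lemma is_adj_norm_le:
  assumes "is_adj T S" shows "norm S \<le> norm T"
proof (rule norm_blinfun_bound)
  fix x
  have "norm (S x) * norm (S x) = inner (T (S x)) x"
    using assms unfolding is_adj_def by (simp add: norm_eq_sqrt_inner)
  also have "\<dots> \<le> norm (T (S x)) * norm x" by (rule norm_cauchy_schwarz)
  also have "\<dots> \<le> (norm T * norm (S x)) * norm x" by (rule mult_right_mono[OF norm_blinfun]) simp
  finally have *: "norm (S x) * norm (S x) \<le> (norm T * norm x) * norm (S x)"
    by (simp add: algebra_simps)
  show "norm (S x) \<le> norm T * norm x"
  proof (cases "norm (S x) = 0")
    case True
    then show ?thesis using mult_nonneg_nonneg[OF norm_ge_zero[of T] norm_ge_zero[of x]] by linarith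
  next
    case False
    then have "0 < norm (S x)" by simp
    then show ?thesis using mult_right_le_imp_le[OF *] by blast
  qed
qed simp

lemma is_adj_sym: "is_adj T S \<Longrightarrow> is_adj S T"
  unfolding is_adj_def by (metis inner_commute)

lemma is_adj_norm: "is_adj T S \<Longrightarrow> norm S = norm T"
  using is_adj_norm_le[of T S] is_adj_norm_le[OF is_adj_sym[of T S]] by (meson antisym)

lemma is_adj_diff: "is_adj T S \<Longrightarrow> is_adj T' S' \<Longrightarrow> is_adj (T - T') (S - S')"
  by (simp add: is_adj_def blinfun.diff_left inner_diff_left inner_diff_right)

lemma is_adj_cstar:
  assumes "is_adj T S" shows "norm (S o\<^sub>L T) = (norm T)\<^sup>2"
proof (rule antisym)
  show "norm (S o\<^sub>L T) \<le> (norm T)\<^sup>2"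
    using norm_blinfun_compose[of S T] is_adj_norm[OF assms] by (simp add: power2_eq_square)
  have "norm T \<le> sqrt (norm (S o\<^sub>L T))"
  proof (rule norm_blinfun_bound)
    fix x
    have "(norm (T x))\<^sup>2 = inner x ((S o\<^sub>L T) x)"
      using assms by (simp add: is_adj_def power2_norm_eq_inner)
    also have "\<dots> \<le> norm x * norm ((S o\<^sub>L T) x)" by (rule norm_cauchy_schwarz)
    also have "\<dots> \<le> norm x * (norm (S o\<^sub>L T) * norm x)" by (rule mult_left_mono[OF norm_blinfun]) simp
    also have "\<dots> = (sqrt (norm (S o\<^sub>L T)) * norm x)\<^sup>2"
      by (simp add: power_mult_distrib power2_eq_square)
    finally show "norm (T x) \<le> sqrt (norm (S o\<^sub>L T)) * norm x"
      by (rule power2_le_imp_le) simp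
  qed simp
  then have "(norm T)\<^sup>2 \<le> (sqrt (norm (S o\<^sub>L T)))\<^sup>2" by (rule power_mono) simp
  then show "(norm T)\<^sup>2 \<le> norm (S o\<^sub>L T)" by simp
qed

definition adj_op :: "('i ell2 \<Rightarrow>\<^sub>L 'i ell2) \<Rightarrow> 'i ell2 \<Rightarrow>\<^sub>L 'i ell2" where
  "adj_op T = Blinfun (adjoint (blinfun_apply T))"

lemma adj_op_eq:
  assumes "is_adj T S" shows "adj_op T = S"
proof -
  have "adjoint (blinfun_apply T) = blinfun_apply S"
    by (rule adjoint_unique) (use assms in \<open>simp add: is_adj_def\<close>)
  then show ?thesis by (simp add: adj_op_def blinfun_apply_inverse)
qed

text \<open>
  The algebraic tensor product of the matrix algebras of size \<open>2 ^ n\<close>, \<open>n \<ge> 1\<close> (the union of the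
  finite tensor products), as operators on the Hilbert space: the algebra generated by the
  mutually commuting tensor factors.
\<close>

inductive_set uhf_alg :: "(multi_index ell2 \<Rightarrow>\<^sub>L multi_index ell2) set" where
  leg: "1 \<le> n \<Longrightarrow> x \<in> carrier_mat (2 ^ n) (2 ^ n) \<Longrightarrow> leg_op n x \<in> uhf_alg"
| add: "S \<in> uhf_alg \<Longrightarrow> T \<in> uhf_alg \<Longrightarrow> S + T \<in> uhf_alg"
| scale: "T \<in> uhf_alg \<Longrightarrow> cmul_op c o\<^sub>L T \<in> uhf_alg"
| mult: "S \<in> uhf_alg \<Longrightarrow> T \<in> uhf_alg \<Longrightarrow> S o\<^sub>L T \<in> uhf_alg"

lemma id_in_alg: "id_blinfun \<in> uhf_alg"
  using uhf_alg.leg[of 1 "1\<^sub>m (2 ^ 1)"] leg_op_one[of 1] by simp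

lemma cmul_op_0: "cmul_op 0 = 0"
  by (rule op_eqI) (simp add: cmul_op.rep_eq coord_simps)

lemma zero_in_alg: "0 \<in> uhf_alg"
  using uhf_alg.scale[OF id_in_alg, of 0] by (simp add: cmul_op_0)

lemma adj_in_alg: "T \<in> uhf_alg \<Longrightarrow> \<exists>S\<in>uhf_alg. is_adj T S"
proof (induction rule: uhf_alg.induct)
  case (leg n x)
  then show ?case
    by (intro bexI[of _ "leg_op n (mat_adjoint x)"] is_adj_leg uhf_alg.leg mat_adjoint_carrier)
next
  case (add S T)
  then obtain S' T' where "S' \<in> uhf_alg" "is_adj S S'" "T' \<in> uhf_alg" "is_adj T T'" by blast
  then show ?case by (intro bexI[of _ "S' + T'"] is_adj_add uhf_alg.add)
next
  case (scale T c)
  then obtain S where S: "S \<in> uhf_alg" "is_adj T S" by blast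
  have "is_adj (cmul_op c o\<^sub>L T) (S o\<^sub>L cmul_op (cnj c))" by (rule is_adj_compose[OF is_adj_cmul S(2)])
  moreover have "S o\<^sub>L cmul_op (cnj c) = S o\<^sub>L (cmul_op (cnj c) o\<^sub>L id_blinfun)"
    by (rule blinfun_eqI) simp
  moreover have "S o\<^sub>L (cmul_op (cnj c) o\<^sub>L id_blinfun) \<in> uhf_alg"
    by (intro uhf_alg.mult uhf_alg.scale S id_in_alg)
  ultimately show ?case by (intro bexI[of _ "S o\<^sub>L cmul_op (cnj c)"]) simp_all
next
  case (mult S T)
  then obtain S' T' where "S' \<in> uhf_alg" "is_adj S S'" "T' \<in> uhf_alg" "is_adj T T'" by blast
  then show ?case by (intro bexI[of _ "T' o\<^sub>L S'"] is_adj_compose uhf_alg.mult)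
qed

lemma commute_in_alg: "T \<in> uhf_alg \<Longrightarrow> T o\<^sub>L cmul_op c = cmul_op c o\<^sub>L T"
proof (induction rule: uhf_alg.induct)
  case (leg n x)
  show ?case by (rule cmul_leg_commute)
next
  case (add S T)
  then show ?case by (simp add: op_comp.add_left op_comp.add_right)
next
  case (scale T d)
  have "(cmul_op d o\<^sub>L T) o\<^sub>L cmul_op c = cmul_op d o\<^sub>L (T o\<^sub>L cmul_op c)" by (rule blinfun_eqI) simp
  also have "\<dots> = cmul_op d o\<^sub>L (cmul_op c o\<^sub>L T)" by (simp only: scale.IH)
  also have "\<dots> = cmul_op c o\<^sub>L (cmul_op d o\<^sub>L T)"
    by (rule op_eqI) (simp add: cmul_op.rep_eq coord_simps)
  finally show ?case .
next
  case (mult S T)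
  have "(S o\<^sub>L T) o\<^sub>L cmul_op c = S o\<^sub>L (T o\<^sub>L cmul_op c)" by (rule blinfun_eqI) simp
  also have "\<dots> = S o\<^sub>L (cmul_op c o\<^sub>L T)" by (simp only: mult.IH)
  also have "\<dots> = (S o\<^sub>L cmul_op c) o\<^sub>L T" by (rule blinfun_eqI) simp
  also have "\<dots> = (cmul_op c o\<^sub>L S) o\<^sub>L T" by (simp only: mult.IH)
  also have "\<dots> = cmul_op c o\<^sub>L (S o\<^sub>L T)" by (rule blinfun_eqI) simp
  finally show ?case .
qed

lemma closure_approx:
  assumes "T \<in> closure uhf_alg"
  obtains X where "\<And>n. X n \<in> uhf_alg" "X \<longlonglongrightarrow> T"
  using assms unfolding closure_sequential by blast

lemma closure_limit: "(\<And>n. X n \<in> uhf_alg) \<Longrightarrow> X \<longlonglongrightarrow> T \<Longrightarrow> T \<in> closure uhf_alg"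
  unfolding closure_sequential by blast

lemma closure_add:
  assumes "S \<in> closure uhf_alg" "T \<in> closure uhf_alg" shows "S + T \<in> closure uhf_alg"
proof -
  obtain X Y where "\<And>n. X n \<in> uhf_alg" "X \<longlonglongrightarrow> S" "\<And>n. Y n \<in> uhf_alg" "Y \<longlonglongrightarrow> T"
    using assms closure_approx by metis
  then show ?thesis by (intro closure_limit[of "\<lambda>n. X n + Y n"] uhf_alg.add tendsto_add)
qed

lemma closure_mult:
  assumes "S \<in> closure uhf_alg" "T \<in> closure uhf_alg" shows "S o\<^sub>L T \<in> closure uhf_alg"
proof -
  obtain X Y where "\<And>n. X n \<in> uhf_alg" "X \<longlonglongrightarrow> S" "\<And>n. Y n \<in> uhf_alg" "Y \<longlonglongrightarrow> T"
    using assms closure_approx by metis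
  then show ?thesis
    by (intro closure_limit[of "\<lambda>n. X n o\<^sub>L Y n"] uhf_alg.mult op_comp.tendsto)
qed

lemma closure_scale:
  assumes "T \<in> closure uhf_alg" shows "cmul_op c o\<^sub>L T \<in> closure uhf_alg"
proof -
  obtain X where "\<And>n. X n \<in> uhf_alg" "X \<longlonglongrightarrow> T"
    using assms closure_approx by metis
  then show ?thesis
    by (intro closure_limit[of "\<lambda>n. cmul_op c o\<^sub>L X n"] uhf_alg.scale op_comp.tendsto tendsto_const)
qed

lemma closure_commute:
  assumes "T \<in> closure uhf_alg" shows "T o\<^sub>L cmul_op c = cmul_op c o\<^sub>L T"
proof -
  obtain X where X: "\<And>n. X n \<in> uhf_alg" "X \<longlonglongrightarrow> T"
    using assms closure_approx by metis
  have 1: "(\<lambda>n. X n o\<^sub>L cmul_op c) \<longlonglongrightarrow> (T o\<^sub>L cmul_op c)"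
    by (intro op_comp.tendsto X tendsto_const)
  have 2: "(\<lambda>n. cmul_op c o\<^sub>L X n) \<longlonglongrightarrow> (cmul_op c o\<^sub>L T)"
    by (intro op_comp.tendsto X tendsto_const)
  show ?thesis
    by (rule LIMSEQ_unique[OF 1]) (use 2 commute_in_alg[OF X(1)] in simp)
qed

lemma closure_adj:
  assumes "T \<in> closure uhf_alg" shows "\<exists>S\<in>closure uhf_alg. is_adj T S"
proof -
  obtain X where X: "\<And>n. X n \<in> uhf_alg" "X \<longlonglongrightarrow> T"
    using assms closure_approx by metis
  obtain Y where Y: "\<And>n. Y n \<in> uhf_alg" "\<And>n. is_adj (X n) (Y n)"
    using adj_in_alg[OF X(1)] by metis
  have d: "norm (Y m - Y n) = norm (X m - X n)" for m n
    by (rule is_adj_norm[OF is_adj_diff[OF Y(2) Y(2)]])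
  have "Cauchy X" using X(2) by (rule LIMSEQ_imp_Cauchy)
  then have "Cauchy Y" unfolding Cauchy_iff d .
  then obtain S where S: "Y \<longlonglongrightarrow> S" using Cauchy_convergent convergent_def by blast
  have "inner (T x) y = inner x (S y)" for x y
  proof (rule LIMSEQ_unique)
    show "(\<lambda>n. inner (X n x) y) \<longlonglongrightarrow> inner (T x) y"
      by (intro tendsto_intros X(2))
    show "(\<lambda>n. inner (X n x) y) \<longlonglongrightarrow> inner x (S y)"
      using Y(2) unfolding is_adj_def by (simp, intro tendsto_intros S)
  qed
  then show ?thesis using closure_limit[OF Y(1) S] unfolding is_adj_def by blast
qed

lemma closure_adj_op:
  assumes "T \<in> closure uhf_alg" shows "adj_op T \<in> closure uhf_alg" "is_adj T (adj_op T)"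
  using closure_adj[OF assms] adj_op_eq by auto

text \<open>
  The C*-algebra \<open>D\<close>. The operator norm restricts to the unique C*-norm on each finite tensor
  product, so the norm closure is the C*-algebraic infinite tensor product.
\<close>

typedef uhf = "closure uhf_alg" morphisms uhf_op Abs_uhf
  using closure_subset zero_in_alg by blast

setup_lifting type_definition_uhf

lemma cmul_op_of_real:
  fixes T :: "'i ell2 \<Rightarrow>\<^sub>L 'j ell2"
  shows "cmul_op (of_real r) o\<^sub>L T = r *\<^sub>R T"
  by (rule op_eqI) (simp add: cmul_op.rep_eq coord_simps blinfun.scaleR_left scaleR_conv_of_real)

lemma closure_scaleR: "T \<in> closure uhf_alg \<Longrightarrow> r *\<^sub>R T \<in> closure uhf_alg"
  using closure_scale[of T "of_real r"] by (simp add: cmul_op_of_real)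

lemma closure_uminus: "T \<in> closure uhf_alg \<Longrightarrow> - T \<in> closure uhf_alg"
  using closure_scaleR[of T "-1"] by simp

instantiation uhf :: real_vector
begin
lift_definition zero_uhf :: uhf is 0 using closure_subset zero_in_alg by blast
lift_definition plus_uhf :: "uhf \<Rightarrow> uhf \<Rightarrow> uhf" is "(+)" by (rule closure_add)
lift_definition uminus_uhf :: "uhf \<Rightarrow> uhf" is "uminus" by (rule closure_uminus)
lift_definition minus_uhf :: "uhf \<Rightarrow> uhf \<Rightarrow> uhf" is "(-)"
  using closure_add closure_uminus by (metis diff_conv_add_uminus)
lift_definition scaleR_uhf :: "real \<Rightarrow> uhf \<Rightarrow> uhf" is "scaleR" by (rule closure_scaleR)
instance by standard (transfer; simp add: algebra_simps)+
end

instantiation uhf :: real_normed_vector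
begin
lift_definition norm_uhf :: "uhf \<Rightarrow> real" is norm .
definition sgn_uhf :: "uhf \<Rightarrow> uhf" where "sgn_uhf x = x /\<^sub>R norm x"
definition dist_uhf :: "uhf \<Rightarrow> uhf \<Rightarrow> real" where "dist_uhf x y = norm (x - y)"
definition uniformity_uhf :: "(uhf \<times> uhf) filter" where
  [code del]: "uniformity_uhf = (INF e\<in>{0<..}. principal {(x, y). dist x y < e})"
definition open_uhf :: "uhf set \<Rightarrow> bool" where
  [code del]: "open_uhf U \<longleftrightarrow> (\<forall>x\<in>U. eventually (\<lambda>(x', y). x' = x \<longrightarrow> y \<in> U) uniformity)"
instance
proof
  fix x y :: uhf and r :: real
  show "norm x = 0 \<longleftrightarrow> x = 0" by transfer simp
  show "norm (x + y) \<le> norm x + norm y" by transfer (rule norm_triangle_ineq)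
  show "norm (r *\<^sub>R x) = \<bar>r\<bar> * norm x" by transfer simp
qed (rule sgn_uhf_def dist_uhf_def uniformity_uhf_def open_uhf_def)+
end

instance uhf :: banach
proof
  fix X :: "nat \<Rightarrow> uhf" assume X: "Cauchy X"
  have d: "norm (uhf_op (X m) - uhf_op (X n)) = norm (X m - X n)" for m n
    by (simp add: norm_uhf.rep_eq minus_uhf.rep_eq)
  have "Cauchy (\<lambda>n. uhf_op (X n))" using X unfolding Cauchy_iff d .
  then obtain T where T: "(\<lambda>n. uhf_op (X n)) \<longlonglongrightarrow> T" using Cauchy_convergent convergent_def by blast
  have "T \<in> closure uhf_alg"
    by (rule closed_sequentially[OF closed_closure _ T]) (rule uhf_op)
  then have e: "uhf_op (Abs_uhf T) = T" by (simp add: Abs_uhf_inverse)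
  have "(\<lambda>n. norm (uhf_op (X n) - T)) \<longlonglongrightarrow> 0" using T by (simp add: LIM_zero_iff tendsto_norm_zero)
  then have "(\<lambda>n. norm (X n - Abs_uhf T)) \<longlonglongrightarrow> 0"
    by (simp add: norm_uhf.rep_eq minus_uhf.rep_eq e)
  then have "X \<longlonglongrightarrow> Abs_uhf T" by (simp add: LIM_zero_iff tendsto_norm_zero_iff)
  then show "convergent X" by (auto simp: convergent_def)
qed

lemma norm_id_ell2: "norm (id_blinfun :: multi_index ell2 \<Rightarrow>\<^sub>L multi_index ell2) = 1"
proof (rule antisym[OF norm_blinfun_id_le])
  obtain s :: multi_index where True by blast
  have "sq_summable (\<lambda>t. if t = s then 1 else 0)"
    unfolding sq_summable_def
    using summable_on_cong_neutral[of UNIV "{s}" "\<lambda>t. (cmod (if t = s then 1 else 0))\<^sup>2" "\<lambda>t. (cmod (if t = s then 1 else 0))\<^sup>2"]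
    by auto
  then have c: "coord (Abs_ell2 (\<lambda>t. if t = s then 1 else 0)) s = 1" by (simp add: Abs_ell2_inverse)
  define x where "x = Abs_ell2 (\<lambda>t. if t = s then 1 else 0)"
  have "1 \<le> norm x" using coord_le_norm[of x s] c unfolding x_def by simp
  then have "0 < norm x" by linarith
  moreover have "norm x \<le> norm (id_blinfun :: multi_index ell2 \<Rightarrow>\<^sub>L multi_index ell2) * norm x"
    using norm_blinfun[of id_blinfun x] by simp
  ultimately show "1 \<le> norm (id_blinfun :: multi_index ell2 \<Rightarrow>\<^sub>L multi_index ell2)" by simp
qed

instantiation uhf :: real_normed_algebra_1
begin
lift_definition one_uhf :: uhf is id_blinfun using closure_subset id_in_alg by blast
lift_definition times_uhf :: "uhf \<Rightarrow> uhf \<Rightarrow> uhf" is "(o\<^sub>L)" by (rule closure_mult)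
instance
proof
  fix x y z :: uhf and r :: real
  show "x * y * z = x * (y * z)" by transfer (simp add: op_compose_assoc)
  show "(x + y) * z = x * z + y * z" by transfer (rule op_comp.add_left)
  show "x * (y + z) = x * y + x * z" by transfer (rule op_comp.add_right)
  show "(r *\<^sub>R x) * y = r *\<^sub>R (x * y)" by transfer (rule op_comp.scaleR_left)
  show "x * (r *\<^sub>R y) = r *\<^sub>R (x * y)" by transfer (rule op_comp.scaleR_right)
  show "1 * x = x" by transfer (rule blinfun_eqI, simp)
  show "x * 1 = x" by transfer (rule blinfun_eqI, simp)
  show "norm (x * y) \<le> norm x * norm y" by transfer (rule norm_blinfun_compose)
  show n: "norm (1 :: uhf) = 1" by transfer (rule norm_id_ell2)
  show "(0 :: uhf) \<noteq> 1" using n by (metis norm_zero zero_neq_one)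
qed
end

instantiation uhf :: cstar_algebra
begin
lift_definition scaleC_uhf :: "complex \<Rightarrow> uhf \<Rightarrow> uhf" is "\<lambda>c T. cmul_op c o\<^sub>L T" by (rule closure_scale)
lift_definition star_uhf :: "uhf \<Rightarrow> uhf" is adj_op by (rule closure_adj_op)
instance
proof
  fix x y :: uhf and c d :: complex and r :: real
  show "c *\<^sub>C (x + y) = c *\<^sub>C x + c *\<^sub>C y" by transfer (rule op_comp.add_right)
  show "(c + d) *\<^sub>C x = c *\<^sub>C x + d *\<^sub>C x"
    by transfer (rule op_eqI, simp add: cmul_op.rep_eq coord_simps plus_blinfun.rep_eq algebra_simps)
  show "c *\<^sub>C d *\<^sub>C x = (c * d) *\<^sub>C x"
    by transfer (rule op_eqI, simp add: cmul_op.rep_eq coord_simps)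
  show "complex_of_real r *\<^sub>C x = r *\<^sub>R x" by transfer (rule cmul_op_of_real)
  show "(c *\<^sub>C x) * y = c *\<^sub>C (x * y)" by transfer (simp add: op_compose_assoc)
  show "x * (c *\<^sub>C y) = c *\<^sub>C (x * y)"
    by transfer (simp add: closure_commute flip: op_compose_assoc)
  show nc: "norm (c *\<^sub>C x) = cmod c * norm x"
  proof transfer
    fix c and T :: "multi_index ell2 \<Rightarrow>\<^sub>L multi_index ell2"
    have n: "norm (cmul c f) = cmod c * norm f" for c and f :: "multi_index ell2"
    proof -
      have "(norm (cmul c f))\<^sup>2 = (cmod c * norm f)\<^sup>2"
        by (simp add: norm_ell2_sq coord_simps norm_mult power_mult_distrib infsum_cmult_right')
      then show ?thesis by (rule power2_eq_imp_eq) auto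
    qed
    have le: "norm (cmul_op c o\<^sub>L T) \<le> cmod c * norm T"
      for c and T :: "multi_index ell2 \<Rightarrow>\<^sub>L multi_index ell2"
    proof (rule norm_blinfun_bound)
      fix f :: "multi_index ell2"
      show "norm ((cmul_op c o\<^sub>L T) f) \<le> cmod c * norm T * norm f"
        using mult_left_mono[OF norm_blinfun[of T f], of "cmod c"]
        by (simp add: cmul_op.rep_eq n mult.assoc)
    qed simp
    show "norm (cmul_op c o\<^sub>L T) = cmod c * norm T"
    proof (cases "c = 0")
      case True
      then show ?thesis by (simp add: cmul_op_0)
    next
      case False
      have "cmul_op (inverse c) o\<^sub>L (cmul_op c o\<^sub>L T) = T"
        by (rule op_eqI) (use False in \<open>simp add: cmul_op.rep_eq coord_simps\<close>)
      then have "norm T \<le> cmod (inverse c) * norm (cmul_op c o\<^sub>L T)"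
        using le[of "inverse c" "cmul_op c o\<^sub>L T"] by simp
      then have "cmod c * norm T \<le> norm (cmul_op c o\<^sub>L T)"
        using False by (simp add: norm_divide field_simps)
      then show ?thesis using le[of c T] by linarith
    qed
  qed
  show "star (x + y) = star x + star y"
    by transfer (intro adj_op_eq is_adj_add closure_adj_op)
  show "star (c *\<^sub>C x) = cnj c *\<^sub>C star x"
  proof transfer
    fix c and T assume T: "T \<in> closure uhf_alg"
    have "is_adj (cmul_op c o\<^sub>L T) (adj_op T o\<^sub>L cmul_op (cnj c))"
      by (intro is_adj_compose is_adj_cmul closure_adj_op T)
    then show "adj_op (cmul_op c o\<^sub>L T) = cmul_op (cnj c) o\<^sub>L adj_op T"
      by (simp add: adj_op_eq closure_commute closure_adj_op T)
  qed
  show "star (x * y) = star y * star x"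
    by transfer (intro adj_op_eq is_adj_compose closure_adj_op)
  show "star (star x) = x"
    by transfer (rule adj_op_eq, rule is_adj_sym, rule closure_adj_op)
  show "norm (star x * x) = (norm x)\<^sup>2"
    by transfer (intro is_adj_cstar closure_adj_op)
qed
end

text \<open>
  The inclusion of the \<open>n\<close>-th tensor factor into \<open>D\<close>; meaningful for \<open>n \<ge> 1\<close> and square matrices of
  size \<open>2 ^ n\<close>. By \<open>uhf_leg_hom\<close>, \<open>uhf_leg_inj\<close>, \<open>uhf_leg_commute\<close> and \<open>uhf_generated\<close> these are
  injective unital *-homomorphisms with commuting ranges that generate \<open>D\<close>.
\<close>

definition uhf_leg :: "nat \<Rightarrow> complex mat \<Rightarrow> uhf" where
  "uhf_leg n x = Abs_uhf (leg_op n x)"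

lemma uhf_op_leg:
  "1 \<le> n \<Longrightarrow> x \<in> carrier_mat (2 ^ n) (2 ^ n) \<Longrightarrow> uhf_op (uhf_leg n x) = leg_op n x"
  unfolding uhf_leg_def
  by (rule Abs_uhf_inverse, rule subsetD[OF closure_subset], rule uhf_alg.leg)

lemma uhf_leg_hom:
  assumes n: "1 \<le> n" and x: "x \<in> carrier_mat (2 ^ n) (2 ^ n)" and y: "y \<in> carrier_mat (2 ^ n) (2 ^ n)"
  shows "uhf_leg n (x + y) = uhf_leg n x + uhf_leg n y"
    and "uhf_leg n (c \<cdot>\<^sub>m x) = c *\<^sub>C uhf_leg n x"
    and "uhf_leg n (x * y) = uhf_leg n x * uhf_leg n y"
    and "uhf_leg n (mat_adjoint x) = star (uhf_leg n x)"
    and "uhf_leg n (1\<^sub>m (2 ^ n)) = 1"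
proof -
  note simps = uhf_op_inject[symmetric] uhf_op_leg[OF n]
  have c: "x + y \<in> carrier_mat (2 ^ n) (2 ^ n)" "c \<cdot>\<^sub>m x \<in> carrier_mat (2 ^ n) (2 ^ n)"
    "x * y \<in> carrier_mat (2 ^ n) (2 ^ n)" "mat_adjoint x \<in> carrier_mat (2 ^ n) (2 ^ n)"
    "1\<^sub>m (2 ^ n) \<in> carrier_mat (2 ^ n) (2 ^ n)"
    using x y mat_adjoint_carrier by auto
  show "uhf_leg n (x + y) = uhf_leg n x + uhf_leg n y"
    by (simp add: simps c x y plus_uhf.rep_eq leg_op_add)
  show "uhf_leg n (c \<cdot>\<^sub>m x) = c *\<^sub>C uhf_leg n x"
    by (simp add: simps c x scaleC_uhf.rep_eq leg_op_smult)
  show "uhf_leg n (x * y) = uhf_leg n x * uhf_leg n y"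
    by (simp add: simps c x y times_uhf.rep_eq leg_op_mult)
  show "uhf_leg n (mat_adjoint x) = star (uhf_leg n x)"
    by (simp add: simps c x star_uhf.rep_eq adj_op_eq[OF is_adj_leg])
  show "uhf_leg n (1\<^sub>m (2 ^ n)) = 1"
    by (simp add: simps c one_uhf.rep_eq leg_op_one)
qed

lemma uhf_leg_inj:
  assumes n: "1 \<le> n" and x: "x \<in> carrier_mat (2 ^ n) (2 ^ n)" and y: "y \<in> carrier_mat (2 ^ n) (2 ^ n)"
    and eq: "uhf_leg n x = uhf_leg n y"
  shows "x = y"
proof (rule eq_matI)
  fix i j assume ij: "i < dim_row y" "j < dim_col y"
  then have i: "i < 2 ^ n" and j: "j < 2 ^ n" using y by auto
  have op: "leg_op n x = leg_op n y" using uhf_op_leg[OF n x] uhf_op_leg[OF n y] eq by simp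
  obtain s0 :: multi_index where True by blast
  define s t where "s = set_digit s0 n i" and "t = set_digit s0 n j"
  define f where "f = Abs_ell2 (\<lambda>r. if r = t then 1 else 0 :: complex)"
  have "sq_summable (\<lambda>r. if r = t then 1 else 0)"
    unfolding sq_summable_def
    using summable_on_cong_neutral[of UNIV "{t}" "\<lambda>r. (cmod (if r = t then 1 else 0))\<^sup>2"
        "\<lambda>r. (cmod (if r = t then 1 else 0))\<^sup>2"] by auto
  then have f: "coord f = (\<lambda>r. if r = t then 1 else 0)" by (simp add: f_def Abs_ell2_inverse)
  have ds: "digit s n = i" using i by (simp add: s_def digit_set_digit)
  have k: "set_digit s n k = t \<longleftrightarrow> k = j" if "k < 2 ^ n" for k
  proof
    assume "set_digit s n k = t"
    then have "digit (set_digit s n k) n = digit t n" by simp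
    then show "k = j" using that j by (simp add: digit_set_digit t_def)
  qed (use i j in \<open>simp add: s_def t_def set_digit_same\<close>)
  have "coord (leg_op n z f) s = z $$ (i, j)" for z
  proof -
    have "coord (leg_op n z f) s = (\<Sum>l<2 ^ n. if l = j then z $$ (i, j) else 0)"
      unfolding coord_leg_op f by (rule sum.cong) (auto simp: k ds)
    then show ?thesis using j by (simp add: sum.delta)
  qed
  then show "x $$ (i, j) = y $$ (i, j)" using op by metis
qed (use x y in auto)

lemma uhf_leg_commute:
  assumes "1 \<le> m" "1 \<le> n" "m \<noteq> n" "x \<in> carrier_mat (2 ^ m) (2 ^ m)" "y \<in> carrier_mat (2 ^ n) (2 ^ n)"
  shows "uhf_leg m x * uhf_leg n y = uhf_leg n y * uhf_leg m x"
  using assms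
  by (simp add: uhf_op_inject[symmetric] times_uhf.rep_eq uhf_op_leg leg_op_commute)

lemma uhf_dist: "dist x y = dist (uhf_op x) (uhf_op y)"
  by (simp add: dist_norm norm_uhf.rep_eq minus_uhf.rep_eq)

lemma uhf_generated:
  assumes "closed S"
    and leg: "\<And>n x. 1 \<le> n \<Longrightarrow> x \<in> carrier_mat (2 ^ n) (2 ^ n) \<Longrightarrow> uhf_leg n x \<in> S"
    and add: "\<And>a b. a \<in> S \<Longrightarrow> b \<in> S \<Longrightarrow> a + b \<in> S"
    and scale: "\<And>c a. a \<in> S \<Longrightarrow> c *\<^sub>C a \<in> S"
    and mult: "\<And>a b. a \<in> S \<Longrightarrow> b \<in> S \<Longrightarrow> a * b \<in> S"
  shows "a \<in> S"
proof -
  have alg: "T \<in> uhf_alg \<Longrightarrow> \<exists>b\<in>S. uhf_op b = T" for T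
  proof (induction rule: uhf_alg.induct)
    case (leg n x)
    then show ?case by (intro bexI[of _ "uhf_leg n x"] uhf_op_leg assms(2))
  next
    case (add A B)
    then obtain a b where "a \<in> S" "uhf_op a = A" "b \<in> S" "uhf_op b = B" by blast
    then show ?case by (intro bexI[of _ "a + b"] assms(3)) (simp_all add: plus_uhf.rep_eq)
  next
    case (scale A c)
    then obtain a where "a \<in> S" "uhf_op a = A" by blast
    then show ?case by (intro bexI[of _ "c *\<^sub>C a"] assms(4)) (simp_all add: scaleC_uhf.rep_eq)
  next
    case (mult A B)
    then obtain a b where "a \<in> S" "uhf_op a = A" "b \<in> S" "uhf_op b = B" by blast
    then show ?case by (intro bexI[of _ "a * b"] assms(5)) (simp_all add: times_uhf.rep_eq)
  qed
  obtain X where X: "\<And>n. X n \<in> uhf_alg" "X \<longlonglongrightarrow> uhf_op a"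
    using closure_approx[OF uhf_op[of a]] by metis
  obtain Y where Y: "\<And>n. Y n \<in> S" "\<And>n. uhf_op (Y n) = X n"
    using alg[OF X(1)] by metis
  have "Y \<longlonglongrightarrow> a"
    using X(2) unfolding tendsto_dist_iff[of X] tendsto_dist_iff[of Y] uhf_dist Y(2) .
  then show ?thesis using closed_sequentially[OF assms(1), of Y a] Y(1) by blast
qed

text \<open>
  The tensor product of automorphisms \<open>\<alpha> n\<close> of the factors. Automorphisms of C*-algebras are
  automatically continuous; requiring continuity makes uniqueness elementary
  (\<open>tensor_automorphism_unique\<close>). Existence for the family defining \<open>beta\<close> is
  \<open>beta_automorphism\<close>, \<open>beta_continuous\<close> and \<open>beta_leg\<close>.
\<close>

definition tensor_automorphism :: "(nat \<Rightarrow> complex mat \<Rightarrow> complex mat) \<Rightarrow> uhf \<Rightarrow> uhf" where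
  "tensor_automorphism \<alpha> = (THE \<beta>. star_automorphism \<beta> \<and> continuous_on UNIV \<beta> \<and>
     (\<forall>n\<ge>1. \<forall>x\<in>carrier_mat (2 ^ n) (2 ^ n). \<beta> (uhf_leg n x) = uhf_leg n (\<alpha> n x)))"

definition Ad :: "complex mat \<Rightarrow> complex mat \<Rightarrow> complex mat" where
  "Ad u x = u * x * mat_adjoint u"

definition beta_unitary :: "nat \<Rightarrow> complex mat" where
  "beta_unitary n = diag_block_mat [1\<^sub>m (2 ^ (n - 1) + 1), - 1\<^sub>m (2 ^ (n - 1) - 1)]"

definition beta :: "uhf \<Rightarrow> uhf" where
  "beta = tensor_automorphism (\<lambda>n. Ad (beta_unitary n))"

lemma tensor_automorphism_unique:
  assumes "star_automorphism \<beta>" "continuous_on UNIV \<beta>" "star_automorphism \<gamma>" "continuous_on UNIV \<gamma>"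
    and "\<And>n x. 1 \<le> n \<Longrightarrow> x \<in> carrier_mat (2 ^ n) (2 ^ n) \<Longrightarrow> \<beta> (uhf_leg n x) = \<gamma> (uhf_leg n x)"
  shows "\<beta> = \<gamma>"
proof
  fix a
  have "a \<in> {a. \<beta> a = \<gamma> a}"
    by (rule uhf_generated)
      (use assms in \<open>auto simp: star_automorphism_def intro!: closed_Collect_eq\<close>)
  then show "\<beta> a = \<gamma> a" by simp
qed

lemma tensor_automorphism_eqI:
  assumes "star_automorphism \<beta>" "continuous_on UNIV \<beta>"
    and "\<And>n x. 1 \<le> n \<Longrightarrow> x \<in> carrier_mat (2 ^ n) (2 ^ n) \<Longrightarrow> \<beta> (uhf_leg n x) = uhf_leg n (\<alpha> n x)"
  shows "tensor_automorphism \<alpha> = \<beta>"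
  unfolding tensor_automorphism_def
proof (rule the_equality)
  fix \<gamma>
  assume "star_automorphism \<gamma> \<and> continuous_on UNIV \<gamma> \<and>
     (\<forall>n\<ge>1. \<forall>x\<in>carrier_mat (2 ^ n) (2 ^ n). \<gamma> (uhf_leg n x) = uhf_leg n (\<alpha> n x))"
  then show "\<gamma> = \<beta>" by (intro tensor_automorphism_unique) (simp_all add: assms)
qed (use assms in simp)

text \<open>
  To show that \<open>beta\<close> exists, it is implemented by the diagonal unitary on the Hilbert space
  whose entry at a basis sequence is the product of the corresponding diagonal entries. All but
  finitely many labels are \<open>0\<close>, where the diagonal entry is \<open>1\<close>, so this product is finite.
\<close>

definition beta_diag :: "nat \<Rightarrow> nat \<Rightarrow> complex" where
  "beta_diag n i = (if i < 2 ^ (n - 1) + 1 then 1 else - 1)"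

lemma two_pow_split: "1 \<le> n \<Longrightarrow> (2::nat) ^ (n - 1) + 1 + (2 ^ (n - 1) - 1) = 2 ^ n"
  by (cases n) auto

lemma beta_unitary_carrier: "1 \<le> n \<Longrightarrow> beta_unitary n \<in> carrier_mat (2 ^ n) (2 ^ n)"
  using two_pow_split[of n]
  by (auto simp: beta_unitary_def dim_diag_block_mat intro!: carrier_matI)

lemma beta_unitary_index:
  assumes "1 \<le> n" "i < 2 ^ n" "j < 2 ^ n"
  shows "beta_unitary n $$ (i, j) = (if i = j then beta_diag n i else 0)"
  using assms two_pow_split[of n]
  by (auto simp: beta_unitary_def beta_diag_def Let_def) linarith

lemma mat_mult_index:
  assumes "A \<in> carrier_mat m n" "B \<in> carrier_mat n k" "i < m" "j < k"
  shows "(A * B) $$ (i, j) = (\<Sum>l<n. A $$ (i, l) * B $$ (l, j))"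
  using assms by (simp add: scalar_prod_def atLeast0LessThan)

lemma Ad_beta_unitary_index:
  assumes n: "1 \<le> n" and x: "x \<in> carrier_mat (2 ^ n) (2 ^ n)" and i: "i < 2 ^ n" and j: "j < 2 ^ n"
  shows "Ad (beta_unitary n) x $$ (i, j) = beta_diag n i * x $$ (i, j) * beta_diag n j"
proof -
  let ?u = "beta_unitary n"
  note u = beta_unitary_carrier[OF n]
  have ux: "(?u * x) $$ (i, k) = beta_diag n i * x $$ (i, k)" if k: "k < 2 ^ n" for k
  proof -
    have "(?u * x) $$ (i, k) = (\<Sum>l<2 ^ n. ?u $$ (i, l) * x $$ (l, k))"
      by (rule mat_mult_index[OF u x i k])
    also have "\<dots> = (\<Sum>l<2 ^ n. if l = i then beta_diag n i * x $$ (i, k) else 0)"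
      by (rule sum.cong) (auto simp: beta_unitary_index[OF n i])
    finally show ?thesis using i by (simp add: sum.delta)
  qed
  have "Ad ?u x $$ (i, j) = (\<Sum>l<2 ^ n. (?u * x) $$ (i, l) * mat_adjoint ?u $$ (l, j))"
    unfolding Ad_def by (rule mat_mult_index[OF mult_carrier_mat[OF u x] mat_adjoint_carrier[OF u] i j])
  also have "\<dots> = (\<Sum>l<2 ^ n. if l = j then beta_diag n i * x $$ (i, j) * beta_diag n j else 0)"
    by (rule sum.cong)
      (auto simp: ux mat_adjoint_index[OF u _ j] beta_unitary_index[OF n j] beta_diag_def)
  finally show ?thesis using j by (simp add: sum.delta)
qed

lemma Ad_beta_unitary_carrier:
  "1 \<le> n \<Longrightarrow> x \<in> carrier_mat (2 ^ n) (2 ^ n) \<Longrightarrow> Ad (beta_unitary n) x \<in> carrier_mat (2 ^ n) (2 ^ n)"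
  using beta_unitary_carrier[of n] mat_adjoint_carrier[OF beta_unitary_carrier[of n]]
  by (auto simp: Ad_def)

definition beta_sign :: "multi_index \<Rightarrow> complex" where
  "beta_sign s = (\<Prod>n\<in>{n. digit s n \<noteq> 0}. beta_diag n (digit s n))"

lemma beta_diag_sq: "beta_diag n i * beta_diag n i = 1"
  by (simp add: beta_diag_def)

lemma beta_sign_split:
  "beta_sign s = beta_diag n (digit s n) * (\<Prod>k\<in>{k. digit s k \<noteq> 0} - {n}. beta_diag k (digit s k))"
proof -
  have fin: "finite {k. digit s k \<noteq> 0}" using digit[of s] by simp
  show ?thesis
  proof (cases "digit s n = 0")
    case True
    then show ?thesis by (simp add: beta_sign_def beta_diag_def)
  next
    case False
    then show ?thesis unfolding beta_sign_def by (subst prod.remove[OF fin, of n]) auto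
  qed
qed

lemma prod_sq_one: "(\<And>k. k \<in> A \<Longrightarrow> g k * g k = (1::complex)) \<Longrightarrow> prod g A * prod g A = 1"
  by (simp add: prod.distrib[symmetric])

lemma beta_sign_sq: "beta_sign s * beta_sign s = 1"
  unfolding beta_sign_def by (rule prod_sq_one) (rule beta_diag_sq)

lemma beta_sign_set_digit:
  assumes "j < 2 ^ n"
  shows "beta_sign s * beta_sign (set_digit s n j) = beta_diag n (digit s n) * beta_diag n j"
proof -
  let ?R = "\<lambda>t. \<Prod>k\<in>{k. digit t k \<noteq> 0} - {n}. beta_diag k (digit t k)"
  have 1: "?R (set_digit s n j) = ?R s"
    by (rule prod.cong) (use assms in \<open>auto simp: digit_set_digit\<close>)
  have 2: "?R s * ?R s = 1" by (rule prod_sq_one) (rule beta_diag_sq)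
  have 3: "beta_sign (set_digit s n j) = beta_diag n j * ?R (set_digit s n j)"
    using beta_sign_split[of "set_digit s n j" n] assms by (simp add: digit_set_digit)
  have "beta_sign s * beta_sign (set_digit s n j) =
      (beta_diag n (digit s n) * ?R s) * (beta_diag n j * ?R s)"
    unfolding beta_sign_split[of s n] 3 1 by (rule refl)
  also have "\<dots> = (beta_diag n (digit s n) * beta_diag n j) * (?R s * ?R s)"
    by (simp only: ac_simps)
  finally show ?thesis unfolding 2 by simp
qed

lemma cmod_beta_sign: "cmod (beta_sign s) = 1"
proof -
  have "(cmod (beta_sign s))\<^sup>2 = 1\<^sup>2"
    using arg_cong[OF beta_sign_sq[of s], of cmod] by (simp add: norm_mult power2_eq_square)
  then show ?thesis by (rule power2_eq_imp_eq) simp_all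
qed

lift_definition sign_map :: "multi_index ell2 \<Rightarrow> multi_index ell2" is "\<lambda>f s. beta_sign s * f s"
  by (simp add: sq_summable_def norm_mult cmod_beta_sign)

lift_definition sign_op :: "multi_index ell2 \<Rightarrow>\<^sub>L multi_index ell2" is sign_map
proof (rule bounded_linear_intro)
  fix x y :: "multi_index ell2" and r :: real
  show "sign_map (x + y) = sign_map x + sign_map y" "sign_map (r *\<^sub>R x) = r *\<^sub>R sign_map x"
    by (rule ell2_eqI; simp add: coord_simps sign_map.rep_eq algebra_simps)+
  have "(norm (sign_map x))\<^sup>2 = (norm x)\<^sup>2"
    by (simp add: norm_ell2_sq sign_map.rep_eq norm_mult cmod_beta_sign)
  then show "norm (sign_map x) \<le> norm x * 1"
    using power2_eq_imp_eq[of "norm (sign_map x)" "norm x"] by simp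
qed

lemma coord_sign_op: "coord (sign_op f) s = beta_sign s * coord f s"
  by (simp add: sign_op.rep_eq sign_map.rep_eq)

lemma sign_op_sq: "sign_op o\<^sub>L sign_op = id_blinfun"
proof (rule op_eqI)
  fix f s
  show "coord ((sign_op o\<^sub>L sign_op) f) s = coord (id_blinfun f) s"
    using beta_sign_sq[of s] by (simp add: coord_sign_op flip: mult.assoc)
qed

lemma sign_op_sq_apply: "sign_op (sign_op f) = f"
  using arg_cong[OF sign_op_sq, of "\<lambda>T. blinfun_apply T f"] by simp

lemma cnj_beta_sign: "cnj (beta_sign s) = beta_sign s"
  by (simp add: beta_sign_def beta_diag_def if_distrib cong: if_cong)

lemma is_adj_sign: "is_adj sign_op sign_op"
  unfolding is_adj_def
proof (intro allI)
  fix x y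
  have i: "inner (c * a) b = inner a (cnj c * b)" for a b c :: complex
    by (simp add: inner_complex_def algebra_simps)
  show "inner (sign_op x) y = inner x (sign_op y)"
    by (simp add: inner_ell2.rep_eq coord_sign_op i cnj_beta_sign)
qed

definition sign_conj :: "(multi_index ell2 \<Rightarrow>\<^sub>L multi_index ell2) \<Rightarrow> multi_index ell2 \<Rightarrow>\<^sub>L multi_index ell2" where
  "sign_conj T = sign_op o\<^sub>L (T o\<^sub>L sign_op)"

lemma sign_conj_leg:
  assumes n: "1 \<le> n" and x: "x \<in> carrier_mat (2 ^ n) (2 ^ n)"
  shows "sign_conj (leg_op n x) = leg_op n (Ad (beta_unitary n) x)"
proof (rule op_eqI)
  fix f s
  have "beta_sign s * (x $$ (digit s n, j) * (beta_sign (set_digit s n j) * coord f (set_digit s n j))) =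
      Ad (beta_unitary n) x $$ (digit s n, j) * coord f (set_digit s n j)" if "j < 2 ^ n" for j
  proof -
    have "beta_sign s * (x $$ (digit s n, j) * (beta_sign (set_digit s n j) * coord f (set_digit s n j))) =
        (beta_sign s * beta_sign (set_digit s n j)) * (x $$ (digit s n, j) * coord f (set_digit s n j))"
      by (simp only: ac_simps)
    also have "\<dots> = Ad (beta_unitary n) x $$ (digit s n, j) * coord f (set_digit s n j)"
      using Ad_beta_unitary_index[OF n x digit_less that] beta_sign_set_digit[OF that]
      by (simp only: ac_simps)
    finally show ?thesis .
  qed
  then show "coord (sign_conj (leg_op n x) f) s = coord (leg_op n (Ad (beta_unitary n) x) f) s"
    unfolding sign_conj_def blinfun_apply_blinfun_compose coord_sign_op coord_leg_op sum_distrib_left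
    by (intro sum.cong refl) simp_all
qed

lemma sign_conj_add: "sign_conj (S + T) = sign_conj S + sign_conj T"
  by (simp add: sign_conj_def op_comp.add_left op_comp.add_right)

lemma sign_conj_mult: "sign_conj (S o\<^sub>L T) = sign_conj S o\<^sub>L sign_conj T"
  by (rule blinfun_eqI) (simp add: sign_conj_def sign_op_sq_apply)

lemma sign_conj_scale: "sign_conj (cmul_op c o\<^sub>L T) = cmul_op c o\<^sub>L sign_conj T"
  by (rule op_eqI) (simp add: sign_conj_def coord_sign_op cmul_op.rep_eq coord_simps)

lemma sign_conj_sign_conj: "sign_conj (sign_conj T) = T"
  by (rule blinfun_eqI) (simp add: sign_conj_def sign_op_sq_apply)

lemma sign_conj_tendsto: "(X \<longlongrightarrow> T) F \<Longrightarrow> ((\<lambda>n. sign_conj (X n)) \<longlongrightarrow> sign_conj T) F"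
  unfolding sign_conj_def by (intro op_comp.tendsto tendsto_const)

lemma sign_conj_norm: "norm (sign_conj T) \<le> norm T * (norm sign_op * norm sign_op)"
proof -
  have "norm (sign_conj T) \<le> norm sign_op * norm (T o\<^sub>L sign_op)"
    unfolding sign_conj_def by (rule norm_blinfun_compose)
  also have "\<dots> \<le> norm sign_op * (norm T * norm sign_op)"
    by (rule mult_left_mono[OF norm_blinfun_compose norm_ge_zero])
  finally show ?thesis by (simp only: ac_simps)
qed

lemma sign_conj_alg: "T \<in> uhf_alg \<Longrightarrow> sign_conj T \<in> uhf_alg"
proof (induction rule: uhf_alg.induct)
  case (leg n x)
  then show ?case by (simp add: sign_conj_leg Ad_beta_unitary_carrier uhf_alg.leg)
next
  case (scale T c)
  then show ?case unfolding sign_conj_scale by (intro uhf_alg.scale)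
qed (simp_all add: sign_conj_add sign_conj_mult uhf_alg.add uhf_alg.mult)

lemma sign_conj_closure:
  assumes "T \<in> closure uhf_alg" shows "sign_conj T \<in> closure uhf_alg"
proof -
  obtain X where X: "\<And>n. X n \<in> uhf_alg" "X \<longlonglongrightarrow> T"
    using assms closure_approx by metis
  then show ?thesis
    by (intro closure_limit[of "\<lambda>n. sign_conj (X n)"] sign_conj_alg sign_conj_tendsto)
qed

lift_definition uhf_conj :: "uhf \<Rightarrow> uhf" is sign_conj by (rule sign_conj_closure)

lemma uhf_conj_conj: "uhf_conj (uhf_conj x) = x"
  by transfer (rule sign_conj_sign_conj)

lemma uhf_conj_automorphism: "star_automorphism uhf_conj"
  unfolding star_automorphism_def
proof (intro conjI allI)
  show "bij uhf_conj" by (rule o_bij[of uhf_conj]) (auto simp: uhf_conj_conj)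
  fix x y :: uhf and c :: complex
  show "uhf_conj (x + y) = uhf_conj x + uhf_conj y" by transfer (rule sign_conj_add)
  show "uhf_conj (c *\<^sub>C x) = c *\<^sub>C uhf_conj x" by transfer (rule sign_conj_scale)
  show "uhf_conj (x * y) = uhf_conj x * uhf_conj y" by transfer (rule sign_conj_mult)
  show "uhf_conj (star x) = star (uhf_conj x)"
  proof transfer
    fix T assume T: "T \<in> closure uhf_alg"
    have "is_adj (sign_op o\<^sub>L (T o\<^sub>L sign_op)) ((sign_op o\<^sub>L adj_op T) o\<^sub>L sign_op)"
      by (rule is_adj_compose[OF is_adj_sign is_adj_compose[OF closure_adj_op(2)[OF T] is_adj_sign]])
    then have "adj_op (sign_conj T) = (sign_op o\<^sub>L adj_op T) o\<^sub>L sign_op"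
      unfolding sign_conj_def by (rule adj_op_eq)
    then show "sign_conj (adj_op T) = adj_op (sign_conj T)"
      by (simp add: sign_conj_def op_compose_assoc)
  qed
qed

lemma uhf_conj_continuous: "continuous_on UNIV uhf_conj"
proof -
  have "bounded_linear uhf_conj"
  proof (rule bounded_linear_intro)
    fix x y :: uhf and r :: real
    show "uhf_conj (x + y) = uhf_conj x + uhf_conj y" by transfer (rule sign_conj_add)
    show "uhf_conj (r *\<^sub>R x) = r *\<^sub>R uhf_conj x"
      by transfer (simp add: sign_conj_def op_comp.scaleR_left op_comp.scaleR_right)
    show "norm (uhf_conj x) \<le> norm x * (norm sign_op * norm sign_op)"
      using sign_conj_norm[of "uhf_op x"] by (simp add: norm_uhf.rep_eq uhf_conj.rep_eq)
  qed
  then show ?thesis by (simp add: linear_continuous_on)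
qed

lemma uhf_conj_leg:
  "1 \<le> n \<Longrightarrow> x \<in> carrier_mat (2 ^ n) (2 ^ n) \<Longrightarrow>
    uhf_conj (uhf_leg n x) = uhf_leg n (Ad (beta_unitary n) x)"
  by (simp add: uhf_op_inject[symmetric] uhf_conj.rep_eq uhf_op_leg sign_conj_leg Ad_beta_unitary_carrier)

lemma beta_eq: "beta = uhf_conj"
  unfolding beta_def
  by (rule tensor_automorphism_eqI[OF uhf_conj_automorphism uhf_conj_continuous uhf_conj_leg])

lemma beta_automorphism: "star_automorphism beta"
  unfolding beta_eq by (rule uhf_conj_automorphism)

lemma beta_continuous: "continuous_on UNIV beta"
  unfolding beta_eq by (rule uhf_conj_continuous)

lemma beta_leg:
  "1 \<le> n \<Longrightarrow> x \<in> carrier_mat (2 ^ n) (2 ^ n) \<Longrightarrow> beta (uhf_leg n x) = uhf_leg n (Ad (beta_unitary n) x)"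
  unfolding beta_eq by (rule uhf_conj_leg)

lemma beta_beta: "beta \<circ> beta = id"
  by (simp add: beta_eq fun_eq_iff uhf_conj_conj)

lemma beta_not_id: "beta \<noteq> id"
proof
  assume id: "beta = id"
  define x :: "complex mat" where "x = mat (2 ^ 2) (2 ^ 2) (\<lambda>_. 1)"
  have x: "x \<in> carrier_mat (2 ^ 2) (2 ^ 2)" by (simp add: x_def)
  have "uhf_leg 2 (Ad (beta_unitary 2) x) = uhf_leg 2 x"
    using beta_leg[OF _ x] id by simp
  then have "Ad (beta_unitary 2) x = x"
    by (rule uhf_leg_inj[OF _ Ad_beta_unitary_carrier[OF _ x] x, rotated 2]) simp_all
  moreover have "Ad (beta_unitary 2) x $$ (0, 3) = beta_diag 2 0 * x $$ (0, 3) * beta_diag 2 3"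
    by (rule Ad_beta_unitary_index[OF _ x]) simp_all
  ultimately show False by (simp add: x_def beta_diag_def)
qed

end

theory Submission
  imports Defs
begin

text \<open>
  Suppose that a projection \<open>e\<close> of \<open>D\<close> satisfied \<open>norm (beta e - (1 - e)) < 1\<close>, as the strict
  Rokhlin property for \<open>\<epsilon> = 1\<close> requires. The symmetry \<open>s = 2 e - 1\<close> is then close to its own
  negative under \<open>beta\<close>, so its odd part \<open>s - beta s\<close>, up to a factor \<open>2\<close>, is within distance less
  than \<open>1\<close> of \<open>s\<close> and is therefore invertible. Invertibility is stable under small perturbations,
  so approximating \<open>s\<close> by an element of some finite tensor product of matrix algebras and taking the
  odd part there yields an injective matrix \<open>T\<close> with \<open>beta T = - T\<close>.

  This contradicts a dimension count. On the finite tensor product of the first \<open>m\<close> factors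
  \<open>beta\<close> is conjugation by the diagonal unitary \<open>w\<close> whose trace is the product of the traces of the
  \<open>m\<close> given unitaries. Each of these has trace \<open>2\<close>, so the trace of \<open>w\<close> is \<open>2 ^ m\<close>, and the
  eigenspace of \<open>w\<close> for \<open>1\<close> is larger than that for \<open>- 1\<close>
  (\<open>more_positive_signs\<close>). An odd \<open>T\<close> anticommutes with \<open>w\<close>, hence maps the first eigenspace into
  the second and has a kernel (\<open>odd_kernel\<close>). The normalized trace \<open>2 ^ m / 2 ^ (1 + \<dots> + m)\<close>
  tends to \<open>0\<close>, so an estimate on traces in \<open>D\<close> alone would not give a contradiction: it is the
  integrality of the dimensions that does.
\<close>

section \<open>Vectors with prescribed support\<close>

definition supported :: "'i set \<Rightarrow> 'i ell2 set" where
  "supported A = {f. \<forall>s. s \<notin> A \<longrightarrow> coord f s = 0}"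

lemma supportedI: "(\<And>s. s \<notin> A \<Longrightarrow> coord f s = 0) \<Longrightarrow> f \<in> supported A"
  by (simp add: supported_def)

lemma supportedD: "f \<in> supported A \<Longrightarrow> s \<notin> A \<Longrightarrow> coord f s = 0"
  by (simp add: supported_def)

lift_definition basis_vec :: "'i \<Rightarrow> 'i ell2" is "\<lambda>s t. if t = s then 1 else 0"
proof -
  fix s :: 'i
  show "sq_summable (\<lambda>t. if t = s then 1 else 0)"
    unfolding sq_summable_def
    by (subst summable_on_cong_neutral[of "{s}" UNIV _ "\<lambda>t. (cmod (if t = s then 1 else 0))\<^sup>2"]) auto
qed

lemma inj_basis_vec: "inj basis_vec"
proof (rule injI)
  fix s t :: 'i
  assume "basis_vec s = basis_vec t"
  then have "coord (basis_vec s) s = coord (basis_vec t) s" by simp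
  then show "s = t" by (simp add: basis_vec.rep_eq split: if_splits)
qed

interpretation ell2: vector_space "cmul :: complex \<Rightarrow> 'i ell2 \<Rightarrow> 'i ell2"
  by standard (rule ell2_eqI; simp add: coord_simps algebra_simps)+

lemma coord_basis_comb:
  assumes "finite A"
  shows "coord (\<Sum>s\<in>A. cmul (c s) (basis_vec s)) t = (if t \<in> A then c t else 0)"
proof -
  have "coord (\<Sum>s\<in>A. cmul (c s) (basis_vec s)) t = (\<Sum>s\<in>A. if s = t then c t else 0)"
    unfolding coord_sum by (rule sum.cong) (auto simp: coord_simps basis_vec.rep_eq)
  then show ?thesis using assms by simp
qed

lemma supported_expand:
  assumes "finite A" "f \<in> supported A"
  shows "f = (\<Sum>s\<in>A. cmul (coord f s) (basis_vec s))"
  by (rule ell2_eqI) (use assms in \<open>simp add: coord_basis_comb supportedD\<close>)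

lemma span_basis_vec:
  assumes "finite A" shows "ell2.span (basis_vec ` A) = supported A"
proof
  have "ell2.subspace (supported A)"
    by (rule ell2.subspaceI) (simp_all add: supported_def coord_simps)
  moreover have "basis_vec ` A \<subseteq> supported A"
    by (auto simp: supported_def basis_vec.rep_eq)
  ultimately show "ell2.span (basis_vec ` A) \<subseteq> supported A" by (intro ell2.span_minimal)
  show "supported A \<subseteq> ell2.span (basis_vec ` A)"
  proof
    fix f assume "f \<in> supported A"
    show "f \<in> ell2.span (basis_vec ` A)"
      by (subst supported_expand[OF assms \<open>f \<in> supported A\<close>])
        (intro ell2.span_sum ell2.span_scale ell2.span_base imageI)
  qed
qed

lemma independent_basis_vec:
  assumes "finite A" shows "ell2.independent (basis_vec ` A)"
proof (rule ell2.independent_if_scalars_zero)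
  fix g x
  assume sum: "(\<Sum>x\<in>basis_vec ` A. cmul (g x) x) = 0" and "x \<in> basis_vec ` A"
  then obtain s where s: "s \<in> A" "x = basis_vec s" by blast
  have "(\<Sum>s\<in>A. cmul (g (basis_vec s)) (basis_vec s)) = 0"
    using sum by (simp add: sum.reindex[OF inj_on_subset[OF inj_basis_vec subset_UNIV]])
  then have "coord (\<Sum>s\<in>A. cmul (g (basis_vec s)) (basis_vec s)) s = 0"
    by (simp add: coord_simps)
  then show "g x = 0" using s by (simp add: coord_basis_comb[OF assms])
qed (use assms in simp)

text \<open>
  A homogeneous linear system with more unknowns than equations has a nontrivial solution.
\<close>

lemma kernel_if_card_less:
  fixes L :: "'i ell2 \<Rightarrow> 'j ell2"
  assumes P: "finite P" and N: "finite N" and less: "card N < card P"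
    and add: "\<And>f g. L (f + g) = L f + L g"
    and scale: "\<And>c f. L (cmul c f) = cmul c (L f)"
    and maps: "\<And>f. f \<in> supported P \<Longrightarrow> L f \<in> supported N"
  shows "\<exists>f\<in>supported P. f \<noteq> 0 \<and> L f = 0"
proof (rule ccontr)
  interpret L: Vector_Spaces.linear cmul cmul L
    by standard (rule add scale)+
  let ?V = "ell2.span (basis_vec ` P)"
  assume "\<not> (\<exists>f\<in>supported P. f \<noteq> 0 \<and> L f = 0)"
  then have "\<forall>f\<in>?V. L f = 0 \<longrightarrow> f = 0" using span_basis_vec[OF P] by blast
  then have inj: "inj_on L ?V" by (rule L.inj_on_iff_eq_0[OF ell2.subspace_span, THEN iffD2])
  have "ell2.independent (L ` basis_vec ` P)"
    by (rule L.independent_injective_image[OF independent_basis_vec[OF P] inj])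
  moreover have "L ` basis_vec ` P \<subseteq> ell2.span (basis_vec ` N)"
    unfolding span_basis_vec[OF N] using maps ell2.span_superset[of "basis_vec ` P"]
    by (auto simp: span_basis_vec[OF P])
  ultimately have "card (L ` basis_vec ` P) \<le> card (basis_vec ` N)"
    using ell2.independent_span_bound N by blast
  moreover have "card (L ` basis_vec ` P) = card P"
    using card_image[OF inj_on_subset[OF inj ell2.span_superset]]
      card_image[OF inj_on_subset[OF inj_basis_vec subset_UNIV]] by simp
  ultimately show False using less card_image_le[OF N, of basis_vec] by linarith
qed

section \<open>Finite tensor products\<close>

text \<open>
  The labels of the standard basis of the tensor product of the first \<open>m\<close> factors; the vectors
  supported there form that tensor product inside the Hilbert space.
\<close>

definition block :: "nat \<Rightarrow> multi_index set" where
  "block m = {s. \<forall>n>m. digit s n = 0}"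

lemma block_0: "\<exists>z. block 0 = {z} \<and> (\<forall>n. digit z n = 0)"
proof -
  have "(\<lambda>_. 0) \<in> {s :: nat \<Rightarrow> nat. (\<forall>n. s n < 2 ^ n) \<and> finite {n. s n \<noteq> 0}}" by simp
  from Abs_multi_index_inverse[OF this] obtain z where z: "digit z = (\<lambda>_. 0)" by blast
  have "s = z" if "s \<in> block 0" for s
  proof (rule multi_index_eqI)
    fix n show "digit s n = digit z n"
      using that digit_less[of s 0] z by (cases n) (auto simp: block_def)
  qed
  then have "block 0 = {z}" by (auto simp: block_def z)
  then show ?thesis using z by auto
qed

lemma block_Suc:
  "bij_betw (\<lambda>(s, j). set_digit s (Suc m) j) (block m \<times> {..<2 ^ Suc m}) (block (Suc m))"
proof (rule bij_betw_byWitness[where f' = "\<lambda>s. (set_digit s (Suc m) 0, digit s (Suc m))"])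
  have "set_digit s (Suc m) 0 = s" if "s \<in> block m" for s
    using that by (intro multi_index_eqI) (simp add: digit_set_digit block_def)
  \<comment> \<open>Unfolding \<open>2 ^ Suc m\<close> would hide the side conditions of the rules on digits.\<close>
  then show "\<forall>p\<in>block m \<times> {..<2 ^ Suc m}.
      (set_digit (case p of (s, j) \<Rightarrow> set_digit s (Suc m) j) (Suc m) 0,
        digit (case p of (s, j) \<Rightarrow> set_digit s (Suc m) j) (Suc m)) = p"
    by (auto simp: set_digit_same digit_set_digit simp del: power_Suc)
  show "\<forall>s\<in>block (Suc m). (case (set_digit s (Suc m) 0, digit s (Suc m)) of
      (s, j) \<Rightarrow> set_digit s (Suc m) j) = s"
    using set_digit_same[OF _ digit_less] by (simp add: set_digit_digit del: power_Suc)
  show "(\<lambda>(s, j). set_digit s (Suc m) j) ` (block m \<times> {..<2 ^ Suc m}) \<subseteq> block (Suc m)"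
    by (auto simp: block_def digit_set_digit simp del: power_Suc)
  show "(\<lambda>s. (set_digit s (Suc m) 0, digit s (Suc m))) ` block (Suc m) \<subseteq> block m \<times> {..<2 ^ Suc m}"
    using digit_less[of _ "Suc m"] by (auto simp: block_def digit_set_digit simp del: power_Suc)
qed

lemma finite_block: "finite (block m)"
proof (induction m)
  case 0
  then show ?case using block_0 by (metis finite.emptyI finite_insert)
next
  case (Suc m)
  then have "finite (block m \<times> {..<(2::nat) ^ Suc m})" by blast
  then show ?case using bij_betw_finite[OF block_Suc] by blast
qed

text \<open>
  Every element of the algebraic tensor product lies in some finite stage, hence acts on the
  tensor product of any sufficiently large number of factors.
\<close>

lemma uhf_alg_block:
  assumes "T \<in> uhf_alg"
  shows "eventually (\<lambda>m. \<forall>f\<in>supported (block m). T f \<in> supported (block m)) sequentially"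
  using assms
proof (induction rule: uhf_alg.induct)
  case (leg n x)
  have "leg_op n x f \<in> supported (block m)" if m: "n \<le> m" and f: "f \<in> supported (block m)" for m f
  proof (rule supportedI)
    fix s assume "s \<notin> block m"
    then obtain k where "k > m" "digit s k \<noteq> 0" by (auto simp: block_def)
    then have "set_digit s n j \<notin> block m" if "j < 2 ^ n" for j
      using m that by (auto simp: block_def digit_set_digit intro!: exI[of _ k])
    then show "coord (leg_op n x f) s = 0"
      unfolding coord_leg_op by (intro sum.neutral ballI) (simp add: supportedD[OF f])
  qed
  then show ?case by (auto intro: eventually_sequentiallyI[of n])
next
  case (add S T)
  from add.IH show ?case
    by eventually_elim (simp add: supported_def coord_simps blinfun.add_left)
next
  case (scale T c)
  from scale.IH show ?case
    by eventually_elim (simp add: supported_def coord_simps cmul_op.rep_eq)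
next
  case (mult S T)
  from mult.IH show ?case by eventually_elim simp
qed

section \<open>The trace of the diagonal unitary\<close>

lemma sum_beta_diag:
  assumes "1 \<le> n" shows "(\<Sum>j<2 ^ n. beta_diag n j) = 2"
proof -
  let ?k = "2 ^ (n - 1) :: nat"
  have "1 \<le> ?k" by simp
  then have "?k + 1 \<le> 2 ^ n" using two_pow_split[OF assms] by linarith
  then have "{..<2 ^ n} = {..<?k + 1} \<union> {?k + 1..<2 ^ n}" by auto
  then have "(\<Sum>j<2 ^ n. beta_diag n j) =
      (\<Sum>j<?k + 1. beta_diag n j) + (\<Sum>j = ?k + 1..<2 ^ n. beta_diag n j)"
    by (metis sum.union_disjoint finite_lessThan finite_atLeastLessThan ivl_disj_int_one(2))
  also have "(\<Sum>j<?k + 1. beta_diag n j) = (\<Sum>j<?k + 1. 1)"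
    by (intro sum.cong) (auto simp: beta_diag_def)
  also have "\<dots> = of_nat (?k + 1)" by simp
  also have "(\<Sum>j = ?k + 1..<2 ^ n. beta_diag n j) = (\<Sum>j = ?k + 1..<2 ^ n. - 1)"
    by (intro sum.cong) (auto simp: beta_diag_def)
  also have "\<dots> = - of_nat (2 ^ n - (?k + 1))" by simp
  also have "2 ^ n - (?k + 1) = ?k - 1"
    using two_pow_split[OF assms] by linarith
  finally show ?thesis by (simp add: of_nat_diff)
qed

text \<open>
  The trace of a tensor product of matrices is the product of the traces.
\<close>

lemma sum_beta_sign: "(\<Sum>s\<in>block m. beta_sign s) = 2 ^ m"
proof (induction m)
  case 0
  obtain z where "block 0 = {z}" "\<forall>n. digit z n = 0" using block_0 by blast
  then show ?case by (simp add: beta_sign_def)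
next
  case (Suc m)
  have sign: "beta_sign (set_digit s (Suc m) j) = beta_sign s * beta_diag (Suc m) j"
    if "s \<in> block m" "j < 2 ^ Suc m" for s j
  proof -
    have "beta_sign s * beta_sign (set_digit s (Suc m) j) = beta_diag (Suc m) j"
      using beta_sign_set_digit[OF that(2), of s] that(1) by (simp add: block_def beta_diag_def)
    then have "beta_sign s * (beta_sign s * beta_sign (set_digit s (Suc m) j)) =
        beta_sign s * beta_diag (Suc m) j" by simp
    then show ?thesis using beta_sign_sq[of s] by (simp flip: mult.assoc)
  qed
  have "(\<Sum>s\<in>block (Suc m). beta_sign s) =
      (\<Sum>(s, j)\<in>block m \<times> {..<2 ^ Suc m}. beta_sign (set_digit s (Suc m) j))"
    by (subst sum.reindex_bij_betw[OF block_Suc, symmetric]) (rule sum.cong, auto)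
  also have "\<dots> = (\<Sum>(s, j)\<in>block m \<times> {..<2 ^ Suc m}. beta_sign s * beta_diag (Suc m) j)"
    by (rule sum.cong) (auto simp: sign simp del: power_Suc)
  also have "\<dots> = (\<Sum>s\<in>block m. beta_sign s) * (\<Sum>j<2 ^ Suc m. beta_diag (Suc m) j)"
    by (simp only: sum_product sum.cartesian_product)
  also have "\<dots> = 2 ^ Suc m"
    using Suc.IH sum_beta_diag[of "Suc m"] by simp
  finally show ?case .
qed

lemma beta_sign_cases: "beta_sign s = 1 \<or> beta_sign s = - 1"
  using beta_sign_sq[of s] by (simp add: square_eq_1_iff)

lemma more_positive_signs:
  "card {s \<in> block m. beta_sign s = - 1} < card {s \<in> block m. beta_sign s = 1}"
    (is "card ?N < card ?P")
proof -
  have "(\<Sum>s\<in>block m. beta_sign s) = (\<Sum>s\<in>?P \<union> ?N. beta_sign s)"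
    using beta_sign_cases by (intro sum.cong) auto
  also have "\<dots> = (\<Sum>s\<in>?P. beta_sign s) + (\<Sum>s\<in>?N. beta_sign s)"
    by (rule sum.union_disjoint) (auto simp: finite_block)
  also have "\<dots> = of_nat (card ?P) - of_nat (card ?N)" by simp
  finally have "(of_nat (card ?P) :: complex) = of_nat (card ?N + 2 ^ m)"
    unfolding sum_beta_sign by (simp add: algebra_simps)
  then have "card ?P = card ?N + 2 ^ m" by (simp only: of_nat_eq_iff)
  then show ?thesis by simp
qed

section \<open>Odd elements are not invertible\<close>

text \<open>
  Oddness means anticommuting with \<open>sign_op\<close>, so \<open>T\<close> maps each of its two eigenspaces into
  the other. On a
  finite stage the one for \<open>1\<close> has the larger dimension.
\<close>

lemma odd_kernel:
  assumes T: "T \<in> uhf_alg" and odd: "sign_conj T = - T"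
  shows "\<exists>f. f \<noteq> 0 \<and> T f = 0"
proof -
  obtain m where m: "\<And>f. f \<in> supported (block m) \<Longrightarrow> T f \<in> supported (block m)"
    using eventually_happens'[OF sequentially_bot uhf_alg_block[OF T]] by blast
  let ?P = "{s \<in> block m. beta_sign s = 1}" and ?N = "{s \<in> block m. beta_sign s = - 1}"
  have swap: "T f \<in> supported ?N" if f: "f \<in> supported ?P" for f
  proof (rule supportedI)
    fix s assume s: "s \<notin> ?N"
    have "sign_op f = f"
      by (rule ell2_eqI) (use f beta_sign_cases in \<open>auto simp: coord_sign_op supported_def\<close>)
    then have "sign_op (T f) = - T f"
      using arg_cong[OF odd, of "\<lambda>S. blinfun_apply S f"] by (simp add: sign_conj_def blinfun.minus_left)
    then have "beta_sign s * coord (T f) s = - coord (T f) s"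
      using coord_sign_op[of "T f" s] by (simp add: coord_simps)
    moreover have "T f \<in> supported (block m)"
      using f by (intro m) (auto simp: supported_def)
    ultimately show "coord (T f) s = 0"
      using s beta_sign_cases[of s] by (cases "s \<in> block m") (auto simp: supported_def)
  qed
  have "T (cmul c f) = cmul c (T f)" for c f
    using arg_cong[OF commute_in_alg[OF T], of "\<lambda>S. blinfun_apply S f"] by (simp add: cmul_op.rep_eq)
  then have "\<exists>f\<in>supported ?P. f \<noteq> 0 \<and> T f = 0"
    by (intro kernel_if_card_less[OF _ _ more_positive_signs[of m] blinfun.add_right _ swap])
      (simp_all add: finite_block)
  then show ?thesis by blast
qed

text \<open>
  For the symmetry \<open>s = 2 e - 1\<close> one has \<open>s + beta s = 2 (beta e - (1 - e))\<close>, so if this has norm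
  less than \<open>2\<close>, then \<open>s - beta s\<close> and all elements near it are injective, being at distance
  less than \<open>2\<close> from twice an isometry.
\<close>

lemma beta_flip_far:
  assumes e: "is_projection e"
  shows "1 \<le> norm (beta e - (1 - e))"
proof (rule ccontr)
  assume "\<not> 1 \<le> norm (beta e - (1 - e))"
  then have close: "norm (beta e - (1 - e)) < 1" by simp
  define s where "s = e + e - 1"
  have ss: "s * s = 1"
    using e by (simp add: s_def is_projection_def algebra_simps)
  have star_1: "star (1 :: uhf) = 1"
    by (metis mult_1_left mult_1_right star_mult star_star)
  have "star s = s"
  proof -
    have "star (s + 1) = s + 1" using e by (simp add: s_def is_projection_def star_add)
    then show ?thesis by (simp add: star_add star_1)
  qed
  then have "(norm s)\<^sup>2 = 1\<^sup>2" using norm_star_mult[of s] ss by simp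
  then have norm_s: "norm s = 1" by (rule power2_eq_imp_eq) simp_all
  have beta_1: "beta 1 = 1"
  proof -
    have "uhf_conj 1 = 1" by transfer (rule blinfun_eqI, simp add: sign_conj_def sign_op_sq_apply)
    then show ?thesis by (simp add: beta_eq)
  qed
  have beta_add: "beta (x + y) = beta x + beta y" for x y
    using beta_automorphism by (simp add: star_automorphism_def)
  have "beta s + 1 = beta e + beta e"
    using beta_add[of s 1] by (simp add: s_def beta_1 beta_add)
  then have "(s - beta s) - 2 *\<^sub>R s = - (2 *\<^sub>R (beta e - (1 - e)))"
    by (simp add: s_def scaleR_2 algebra_simps)
  then have "norm ((s - beta s) - 2 *\<^sub>R s) < 2" using close by simp
  define S where "S = uhf_op s"
  have SS: "S (S f) = f" for f
    using arg_cong[OF ss, of "\<lambda>x. blinfun_apply (uhf_op x) f"]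
    by (simp add: S_def times_uhf.rep_eq one_uhf.rep_eq)
  have S_le: "norm (S f) \<le> norm f" for f
    using norm_blinfun[of S f] norm_s by (simp add: S_def norm_uhf.rep_eq)
  have near: "norm ((S - sign_conj S) - 2 *\<^sub>R S) < 2"
    using \<open>norm ((s - beta s) - 2 *\<^sub>R s) < 2\<close>
    by (simp add: S_def norm_uhf.rep_eq minus_uhf.rep_eq scaleR_uhf.rep_eq beta_eq uhf_conj.rep_eq)
  \<comment> \<open>Taking the odd part of the approximants, rather than approximating the odd part of \<open>S\<close>,
    keeps them exactly odd.\<close>
  obtain X where X: "\<And>n. X n \<in> uhf_alg" "X \<longlonglongrightarrow> S"
    using closure_approx uhf_op unfolding S_def by metis
  have "(\<lambda>n. norm ((X n - sign_conj (X n)) - 2 *\<^sub>R S)) \<longlonglongrightarrow> norm ((S - sign_conj S) - 2 *\<^sub>R S)"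
    by (intro tendsto_intros sign_conj_tendsto X)
  from order_tendstoD(2)[OF this near]
  obtain n where n: "norm ((X n - sign_conj (X n)) - 2 *\<^sub>R S) < 2"
    using eventually_happens'[OF sequentially_bot] by blast
  define T where "T = X n - sign_conj (X n)"
  have minus: "- R \<in> uhf_alg" if "R \<in> uhf_alg" for R
    using uhf_alg.scale[OF that, of "of_real (- 1)"] unfolding cmul_op_of_real by simp
  have "T \<in> uhf_alg"
    using uhf_alg.add[OF X(1) minus[OF sign_conj_alg[OF X(1)]]] by (simp add: T_def)
  moreover have "sign_conj T = - T"
  proof -
    have "sign_conj (X n) = sign_conj T + X n"
      using sign_conj_add[of T "sign_conj (X n)"] by (simp add: T_def sign_conj_sign_conj)
    then show ?thesis by (simp add: T_def algebra_simps)
  qed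
  ultimately obtain f where f: "f \<noteq> 0" "T f = 0" using odd_kernel by blast
  have "2 * norm (S f) = norm ((T - 2 *\<^sub>R S) f)"
    using f by (simp add: blinfun.diff_left blinfun.scaleR_left)
  also have "\<dots> \<le> norm (T - 2 *\<^sub>R S) * norm f" by (rule norm_blinfun)
  also have "\<dots> < 2 * norm f" using n f by (simp add: T_def)
  also have "norm f \<le> norm (S f)" using S_le[of "S f"] by (simp add: SS)
  finally show False by simp
qed

theorem proposition12p5:
  shows "\<not> strict_rokhlin_property 2 beta"
proof
  assume "strict_rokhlin_property 2 beta"
  from this[unfolded strict_rokhlin_property_def, rule_format, of "{}" 1]
  obtain e :: "nat \<Rightarrow> uhf" where e: "\<forall>j<2. is_projection (e j)"
    "\<forall>j. j + 2 \<le> 2 \<longrightarrow> norm (beta (e j) - e (j + 1)) < 1" "(\<Sum>j<2. e j) = 1"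
    by auto
  have "e 1 = 1 - e 0" using e(3) by (simp add: numeral_2_eq_2 algebra_simps)
  then have "norm (beta (e 0) - (1 - e 0)) < 1" using e(2) by auto
  then show False using beta_flip_far[of "e 0"] e(1) by simp
qed

end
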